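(* Suppose that all the state spaces have the same dimension $d_t=d$ and are bounded by a common diameter (i.e. $\mathcal X_t$ is contained in a ball of diameter $D_t\le D$), and let $M:=\max\{M_t:t\in\mathcal T'\}$. Suppose there is $C>0$ such that for each stage $t\in\mathcal T$ the local cost function satisfies $f_t(x_{t-1},x_t;\xi_t)\ge C$ for all $x_{t-1}\in\mathcal X_{t-1}$, $x_t\in\mathcal X_t$ and $\xi_t\in\Xi_t$. Let $\alpha>0$. Then, for a suitable choice of the input $\varepsilon$ of the CDDP algorithm and of the input gap vector $(\delta_t)_{t=1}^T$ of the NDDP algorithm, each of the two algorithms terminates and returns an $\alpha$-relative optimal solution $x_1^*$, and the total numbers of subproblem oracle evaluations (initial and noninitial stage) satisfy, respectively, $$\#\mathrm{Eval}_{\mathrm{CDDP}}\le 1+T(T-1)\left(1+\frac{2MD}{\alpha C}\right)^d,\qquad \#\mathrm{Eval}_{\mathrm{NDDP}}\le 1+2(T-1)\left(1+\frac{2MD}{\alpha C}\right)^d.$$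
   Context: **Problem.** Let $T\ge 2$, $\mathcal T=\{1,\dots,T\}$, $\mathcal T'=\{2,\dots,T\}$. For $t\in\mathcal T$, $\mathcal X_t\subset\mathbb R^{d_t}$ is a nonempty compact convex set (state space); $\Xi_t\subseteq\mathbb R^{m_t}$ is a nonempty uncertainty set (a Borel set; convex or finite); $x_0\in\mathbb R^{d_0}$ and $\xi_1$ are fixed deterministic parameters ($\mathcal X_0=\{x_0\}$, $\Xi_1=\{\xi_1\}$). The cost $f_t:\mathbb R^{d_{t-1}}\times\mathbb R^{d_t}\times\Xi_t\to[0,+\infty]$, $(x_{t-1},x_t,\xi_t)\mapsto f_t(x_{t-1},x_t;\xi_t)$, is lower semicontinuous and is convex in $(x_{t-1},x_t)$ for each $\xi_t$. For $t\in\mathcal T'$, $\mathcal P_t$ is a nonempty set of Borel probability measures on $\Xi_t$. There is $x_1\in\mathcal X_1$ with $f_1(x_0,x_1;\xi_1)<+\infty$. $\|\cdot\|$ is a norm on each $\mathbb R^{d_t}$ (balls are with respect to this norm), and $\|\cdot\|_*$ is its dual norm. **Cost-to-go functions.** $\mathcal Q_T\equiv0$, and for $t=T,\dots,2$: $Q_t(x_{t-1};\xi_t)=\min_{x_t\in\mathcal X_t}f_t(x_{t-1},x_t;\xi_t)+\mathcal Q_t(x_t)$, $\mathcal Q_{t-1}(x_{t-1})=\sup_{p_t\in\mathcal P_t}\mathbb E_{\xi_t\sim p_t}Q_t(x_{t-1};\xi_t)$. **$\alpha$-relative optimality.** $x_1^*\in\mathcal X_1$ is $\alpha$-relative optimal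 if $f_1(x_0,x_1^*;\xi_1)+\mathcal Q_1(x_1^* )\le(1+\alpha)\min_{x_1\in\mathcal X_1}\big(f_1(x_0,x_1;\xi_1)+\mathcal Q_1(x_1)\big)$. **Regularized cost-to-go functions.** Fix $M_t>0$ for $t\in\mathcal T'$. Put $\mathcal Q_T^{\mathrm R}\equiv0$ and, for $t=T,\dots,2$, $$Q_t^{\mathrm R}(x_{t-1};\xi_t)=\max_{\|\lambda_t\|_*\le M_t}\ \inf_{x_t\in\mathcal X_t,\,z_t\in\mathbb R^{d_{t-1}}} f_t(z_t,x_t;\xi_t)+\mathcal Q_t^{\mathrm R}(x_t)+\langle\lambda_t,x_{t-1}-z_t\rangle,$$ $$\mathcal Q_{t-1}^{\mathrm R}(x_{t-1})=\sup_{p_t\in\mathcal P_t}\mathbb E_{\xi_t\sim p_t}Q_t^{\mathrm R}(x_{t-1};\xi_t).$$ Standing assumption: the sets $\mathcal X_t$ ($t\in\mathcal T$) are full-dimensional and, for every $t\in\mathcal T'$ and $\xi_t\in\Xi_t$, $Q_t(\cdot;\xi_t)$ is (real-valued and) $M_t$-Lipschitz continuous on $\mathcal X_{t-1}$ with respect to $\|\cdot\|$. **Single stage subproblem oracles.** Let $\underline{\mathcal Q}_t,\overline{\mathcal Q}_t$ be lower semicontinuous convex functions with values in $\mathbb R\cup\{+\infty\}$ and $\underline{\mathcal Q}_t\le\mathcal Q_t^{\mathrm R}\le\overline{\mathcal Q}_t$ on $\mathcal X_t$ (in the algorithms $\underline{\mathcal Q}_t$ is always real-valued). *Initial stage oracle*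 $\mathscr O_1:(\underline{\mathcal Q}_1,\overline{\mathcal Q}_1)\mapsto(x_1;\gamma_1)$: returns an optimal solution $x_1$ of $\min_{x_1\in\mathcal X_1}f_1(x_0,x_1;\xi_1)+\underline{\mathcal Q}_1(x_1)$ and $\gamma_1=\overline{\mathcal Q}_1(x_1)-\underline{\mathcal Q}_1(x_1)$. *Noninitial stage oracle* ($t\in\mathcal T'$) $\mathscr O_t:(x_{t-1},\underline{\mathcal Q}_t,\overline{\mathcal Q}_t)\mapsto(\mathcal V_{t-1},v_{t-1},x_t;\gamma_t)$: given $x_{t-1}\in\mathcal X_{t-1}$, returns some $x_t\in\mathcal X_t$, an $M_t$-Lipschitz affine function $\mathcal V_{t-1}$ and a value $v_{t-1}\in\mathbb R\cup\{+\infty\}$ such that $\mathcal V_{t-1}\le\mathcal Q_{t-1}^{\mathrm R}$ on $\mathcal X_{t-1}$, $v_{t-1}\ge\mathcal Q_{t-1}^{\mathrm R}(x_{t-1})$, and $v_{t-1}-\mathcal V_{t-1}(x_{t-1})\le\gamma_t:=\overline{\mathcal Q}_t(x_t)-\underline{\mathcal Q}_t(x_t)$. Any oracles satisfying these requirements may be used. **Notation.** $\mathrm{conv}\{h_1,h_2\}(x)=\sup_\lambda\inf_z\{\min\{h_1(z),h_2(z)\}+\langle\lambda,x-z\rangle\}$ (closed convex hull of the epigraphs). **CDDP algorithm.** Input: oracles $\mathscr O_t$, $t\in\mathcal T$, and $\varepsilon>0$. Initialize $\underline{\mathcal Q}_t^0=0$, $\overline{\mathcal Q}_t^0=+\infty$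 for $t<T$; $\underline{\mathcal Q}_T^j=\overline{\mathcal Q}_T^j=0$ for all $j$; $i=1$. Evaluate $(x_1^1;\gamma_1^1)=\mathscr O_1(\underline{\mathcal Q}_1^0,\overline{\mathcal Q}_1^0)$; set $\mathrm{LB}=f_1(x_0,x_1^1;\xi_1)$, $\mathrm{UB}=+\infty$. While $\mathrm{UB}-\mathrm{LB}>\varepsilon$: (1) for $t=2,\dots,T$ evaluate $(\mathcal V_{t-1}^i,v_{t-1}^i,x_t^i;\gamma_t^i)=\mathscr O_t(x_{t-1}^i,\underline{\mathcal Q}_t^{i-1},\overline{\mathcal Q}_t^{i-1})$; (2) for $t=T,\dots,2$ set $\underline{\mathcal Q}_{t-1}^i=\max\{\underline{\mathcal Q}_{t-1}^{i-1},\mathcal V_{t-1}^i\}$ and $\overline{\mathcal Q}_{t-1}^i=\mathrm{conv}\{\overline{\mathcal Q}_{t-1}^{i-1},\,v_{t-1}^i+M_t\|\cdot-x_{t-1}^i\|\}$; (3) evaluate $(x_1^{i+1};\gamma_1^{i+1})=\mathscr O_1(\underline{\mathcal Q}_1^i,\overline{\mathcal Q}_1^i)$, set $\mathrm{LB}=f_1(x_0,x_1^{i+1};\xi_1)+\underline{\mathcal Q}_1^i(x_1^{i+1})$ and $\mathrm{UB}'=f_1(x_0,x_1^{i+1};\xi_1)+\overline{\mathcal Q}_1^i(x_1^{i+1})$; if $\mathrm{UB}'<\mathrm{UB}$, set $x_1^*=x_1^{i+1}$ and $\mathrm{UB}=\mathrm{UB}'$; then $i\leftarrow i+1$. The algorithm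 terminates when the while-loop ends and returns $x_1^*$. **NDDP algorithm.** Input: oracles $\mathscr O_t$, $t\in\mathcal T$, and gaps $\varepsilon=\delta_1>\delta_2>\cdots>\delta_T=0$. The algorithm maintains current approximations $\underline{\mathcal Q}_t,\overline{\mathcal Q}_t$ and current states $x_t$. Initialize $\underline{\mathcal Q}_t=0$, $\overline{\mathcal Q}_t=+\infty$ for $t<T$; $\underline{\mathcal Q}_T=\overline{\mathcal Q}_T=0$ (never changed); $\mathrm{LB}=0$, $\mathrm{UB}=+\infty$; current stage $t=1$. Repeat: (a) If $t=1$: evaluate $(x_1;\gamma_1)=\mathscr O_1(\underline{\mathcal Q}_1,\overline{\mathcal Q}_1)$ (replacing the current state $x_1$); set $\mathrm{LB}=f_1(x_0,x_1;\xi_1)+\underline{\mathcal Q}_1(x_1)$, $\mathrm{UB}'=f_1(x_0,x_1;\xi_1)+\overline{\mathcal Q}_1(x_1)$; if $\mathrm{UB}'<\mathrm{UB}$, set $x_1^*=x_1$ and $\mathrm{UB}=\mathrm{UB}'$. If $\mathrm{UB}-\mathrm{LB}\le\varepsilon$, terminate and return $x_1^*$; otherwise set $t\leftarrow2$. (b) If $t\ge2$: evaluate $(\mathcal V_{t-1},v_{t-1},x_t;\gamma_t)=\mathscr O_t(x_{t-1},\underline{\mathcal Q}_t,\overline{\mathcal Q}_t)$ at the current state $x_{t-1}$ (replacing the current state $x_t$). If $t<T$ and $\gamma_t>\delta_t$, set $t\leftarrow t+1$ with no update of approximations. Otherwise update $\underline{\mathcal Q}_{t-1}\leftarrow\max\{\underline{\mathcal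 Q}_{t-1},\mathcal V_{t-1}\}$, $\overline{\mathcal Q}_{t-1}\leftarrow\mathrm{conv}\{\overline{\mathcal Q}_{t-1},\,v_{t-1}+M_t\|\cdot-x_{t-1}\|\}$, and set $t\leftarrow t-1$. *)

theory Defs
  imports "HOL-Probability.Probability_Measure" "HOL-Library.While_Combinator"
begin

section \<open>Convex analysis preliminaries\<close>

definition is_norm :: "('a::real_vector \<Rightarrow> real) \<Rightarrow> bool" where
  "is_norm N \<longleftrightarrow>
     (\<forall>x. 0 \<le> N x) \<and> (\<forall>x. N x = 0 \<longleftrightarrow> x = 0) \<and>
     (\<forall>c x. N (c *\<^sub>R x) = \<bar>c\<bar> * N x) \<and> (\<forall>x y. N (x + y) \<le> N x + N y)"

definition dual_norm :: "('a::real_inner \<Rightarrow> real) \<Rightarrow> 'a \<Rightarrow> real" where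
  "dual_norm N l = (SUP x\<in>{x. N x \<le> 1}. l \<bullet> x)"

definition norm_cball :: "('a::real_vector \<Rightarrow> real) \<Rightarrow> 'a \<Rightarrow> real \<Rightarrow> 'a set" where
  "norm_cball N c r = {x. N (x - c) \<le> r}"

definition lsc_on :: "'a::topological_space set \<Rightarrow> ('a \<Rightarrow> 'b::linorder) \<Rightarrow> bool" where
  "lsc_on S g \<longleftrightarrow> (\<forall>x\<in>S. \<forall>c<g x. eventually (\<lambda>y. c < g y) (at x within S))"

text \<open>Convexity of an extended real function that never takes the value \<open>-\<infinity>\<close>; here
  \<open>0 * \<infinity> = 0\<close>, so the boundary cases \<open>u = 0\<close> and \<open>v = 0\<close> are harmless.\<close>

definition ext_convex :: "('a::real_vector \<Rightarrow> ereal) \<Rightarrow> bool" where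
  "ext_convex g \<longleftrightarrow>
     (\<forall>x y. \<forall>u\<ge>0. \<forall>v\<ge>0. u + v = 1 \<longrightarrow>
        g (u *\<^sub>R x + v *\<^sub>R y) \<le> ereal u * g x + ereal v * g y)"

definition conv2 :: "('a::real_inner \<Rightarrow> ereal) \<Rightarrow> ('a \<Rightarrow> ereal) \<Rightarrow> 'a \<Rightarrow> ereal" where
  "conv2 g h x = (SUP l. INF z. min (g z) (h z) + ereal (l \<bullet> (x - z)))"


section \<open>The multistage problem\<close>

text \<open>Stages are \<open>1, \<dots>, horizon\<close>. All decision spaces of the stages \<open>t \<ge> 1\<close> have the same
  dimension \<open>d = DIM('a)\<close>; the initial state lives in its own space \<open>'b\<close>, whence the separate
  field \<open>cost1\<close> for the first-stage cost. The uncertainty sets are subsets of one common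
  space \<open>'m\<close>: a family of Euclidean spaces of varying dimensions is covered by regarding each of its
  members as a coordinate subspace of \<open>'m\<close>, since all conditions on uncertainty sets, costs and
  measures are relative to the sets \<open>unc_set t\<close>. The norm may depend on the stage. Fields are
  meaningful only at the stages where the predicates below constrain them.\<close>

record ('b, 'a, 'm) problem =
  horizon    :: nat
  state_set  :: "nat \<Rightarrow> 'a set"
  unc_set    :: "nat \<Rightarrow> 'm set"
  init_state :: 'b
  init_param :: 'm
  cost1      :: "'b \<Rightarrow> 'a \<Rightarrow> 'm \<Rightarrow> ennreal"
  cost       :: "nat \<Rightarrow> 'a \<Rightarrow> 'a \<Rightarrow> 'm \<Rightarrow> ennreal"
  ambiguity  :: "nat \<Rightarrow> 'm measure set"
  nrm        :: "nat \<Rightarrow> 'a \<Rightarrow> real"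
  lip        :: "nat \<Rightarrow> real"

definition valid_problem ::
  "('b::euclidean_space, 'a::euclidean_space, 'm::euclidean_space) problem \<Rightarrow> bool" where
  "valid_problem P \<longleftrightarrow>
     2 \<le> horizon P \<and>
     (\<forall>t\<in>{1..horizon P}.
        state_set P t \<noteq> {} \<and> compact (state_set P t) \<and> convex (state_set P t) \<and>
        is_norm (nrm P t) \<and>
        unc_set P t \<noteq> {} \<and> unc_set P t \<in> sets borel \<and>
        (convex (unc_set P t) \<or> finite (unc_set P t))) \<and>
     unc_set P 1 = {init_param P} \<and>
     lsc_on (UNIV \<times> UNIV \<times> unc_set P 1) (\<lambda>(x, y, xi). cost1 P x y xi) \<and>
     (\<forall>xi\<in>unc_set P 1. ext_convex (\<lambda>(x, y). enn2ereal (cost1 P x y xi))) \<and>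
     (\<forall>t\<in>{2..horizon P}.
        lsc_on (UNIV \<times> UNIV \<times> unc_set P t) (\<lambda>(x, y, xi). cost P t x y xi) \<and>
        (\<forall>xi\<in>unc_set P t. ext_convex (\<lambda>(x, y). enn2ereal (cost P t x y xi))) \<and>
        ambiguity P t \<noteq> {} \<and>
        (\<forall>p\<in>ambiguity P t.
           prob_space p \<and> sets p = sets (restrict_space borel (unc_set P t)))) \<and>
     (\<exists>x\<in>state_set P 1. cost1 P (init_state P) x (init_param P) < \<infinity>)"

definition first_cost :: "('b, 'a, 'm) problem \<Rightarrow> 'a \<Rightarrow> ennreal" where
  "first_cost P x = cost1 P (init_state P) x (init_param P)"

definition worst_case :: "('b, 'a, 'm) problem \<Rightarrow> nat \<Rightarrow> ('m \<Rightarrow> ennreal) \<Rightarrow> ennreal" where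
  "worst_case P t g = (SUP p\<in>ambiguity P t. \<integral>\<^sup>+ xi. g xi \<partial>p)"

definition stage_value ::
  "('b, 'a, 'm) problem \<Rightarrow> nat \<Rightarrow> ('a \<Rightarrow> ennreal) \<Rightarrow> 'a \<Rightarrow> 'm \<Rightarrow> ennreal" where
  "stage_value P t V x xi = (INF y\<in>state_set P t. cost P t x y xi + V y)"

function cost_to_go :: "('b, 'a, 'm) problem \<Rightarrow> nat \<Rightarrow> 'a \<Rightarrow> ennreal" where
  "cost_to_go P t =
     (if horizon P \<le> t then (\<lambda>x. 0)
      else (\<lambda>x. worst_case P (Suc t) (stage_value P (Suc t) (cost_to_go P (Suc t)) x)))"
  by auto
termination by (relation "Wellfounded.measure (\<lambda>(P, t). horizon P - t)") auto

declare cost_to_go.simps [simp del]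

definition alpha_relative_optimal :: "('b, 'a, 'm) problem \<Rightarrow> real \<Rightarrow> 'a \<Rightarrow> bool" where
  "alpha_relative_optimal P \<alpha> x \<longleftrightarrow>
     x \<in> state_set P 1 \<and>
     first_cost P x + cost_to_go P 1 x
       \<le> ennreal (1 + \<alpha>) * (INF y\<in>state_set P 1. first_cost P y + cost_to_go P 1 y)"


section \<open>Regularization\<close>

definition reg_stage_value ::
  "('b, 'a::real_inner, 'm) problem \<Rightarrow> nat \<Rightarrow> ('a \<Rightarrow> ennreal) \<Rightarrow> 'a \<Rightarrow> 'm \<Rightarrow> ereal" where
  "reg_stage_value P t V x xi =
     (SUP l\<in>{l. dual_norm (nrm P (t - 1)) l \<le> lip P t}.
        INF (y, z)\<in>state_set P t \<times> UNIV.
          enn2ereal (cost P t z y xi + V y) + ereal (l \<bullet> (x - z)))"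

text \<open>For \<open>lip P t > 0\<close> the multiplier \<open>l = 0\<close> is admissible, so \<open>reg_stage_value\<close> is
  nonnegative and \<open>e2ennreal\<close> only changes its type.\<close>

function reg_cost_to_go ::
  "('b, 'a::real_inner, 'm) problem \<Rightarrow> nat \<Rightarrow> 'a \<Rightarrow> ennreal" where
  "reg_cost_to_go P t =
     (if horizon P \<le> t then (\<lambda>x. 0)
      else (\<lambda>x. worst_case P (Suc t)
              (\<lambda>xi. e2ennreal (reg_stage_value P (Suc t) (reg_cost_to_go P (Suc t)) x xi))))"
  by auto
termination by (relation "Wellfounded.measure (\<lambda>(P, t). horizon P - t)") auto

declare reg_cost_to_go.simps [simp del]

definition regularity :: "('b, 'a::euclidean_space, 'm) problem \<Rightarrow> bool" where
  "regularity P \<longleftrightarrow>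
     (\<forall>t\<in>{1..horizon P}. aff_dim (state_set P t) = int DIM('a)) \<and>
     (\<forall>t\<in>{2..horizon P}. 0 < lip P t \<and>
        (\<forall>xi\<in>unc_set P t.
           (\<forall>x\<in>state_set P (t - 1). stage_value P t (cost_to_go P t) x xi < \<infinity>) \<and>
           (\<forall>x\<in>state_set P (t - 1). \<forall>y\<in>state_set P (t - 1).
              \<bar>enn2real (stage_value P t (cost_to_go P t) x xi)
                - enn2real (stage_value P t (cost_to_go P t) y xi)\<bar>
              \<le> lip P t * nrm P (t - 1) (x - y))))"


section \<open>Single stage subproblem oracles\<close>

record 'a stage_output =
  out_cut   :: "'a \<Rightarrow> real"
  out_val   :: ereal
  out_state :: 'a
  out_gap   :: ereal

type_synonym 'a init_oracle = "('a \<Rightarrow> real) \<Rightarrow> ('a \<Rightarrow> ereal) \<Rightarrow> 'a \<times> ereal"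

type_synonym 'a stage_oracle = "'a \<Rightarrow> ('a \<Rightarrow> real) \<Rightarrow> ('a \<Rightarrow> ereal) \<Rightarrow> 'a stage_output"

text \<open>Under-approximations are real-valued, as they always are in the algorithms below; oracles
  are required to answer correctly on such inputs only.\<close>

definition valid_approx ::
  "('b, 'a::euclidean_space, 'm) problem \<Rightarrow> nat \<Rightarrow> ('a \<Rightarrow> real) \<Rightarrow> ('a \<Rightarrow> ereal) \<Rightarrow> bool" where
  "valid_approx P t lo hi \<longleftrightarrow>
     lsc_on UNIV lo \<and> convex_on UNIV lo \<and>
     lsc_on UNIV hi \<and> ext_convex hi \<and> (\<forall>x. hi x \<noteq> -\<infinity>) \<and>
     (\<forall>x\<in>state_set P t.
        ereal (lo x) \<le> enn2ereal (reg_cost_to_go P t x) \<and>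
        enn2ereal (reg_cost_to_go P t x) \<le> hi x)"

definition is_init_oracle ::
  "('b, 'a::euclidean_space, 'm) problem \<Rightarrow> 'a init_oracle \<Rightarrow> bool" where
  "is_init_oracle P O1 \<longleftrightarrow>
     (\<forall>lo hi. valid_approx P 1 lo hi \<longrightarrow>
        (let (x, g) = O1 lo hi in
           x \<in> state_set P 1 \<and>
           (\<forall>y\<in>state_set P 1.
              enn2ereal (first_cost P x) + ereal (lo x)
                \<le> enn2ereal (first_cost P y) + ereal (lo y)) \<and>
           g = hi x - ereal (lo x)))"

definition is_stage_oracle ::
  "('b, 'a::euclidean_space, 'm) problem \<Rightarrow> nat \<Rightarrow> 'a stage_oracle \<Rightarrow> bool" where
  "is_stage_oracle P t Or \<longleftrightarrow>
     (\<forall>x lo hi. x \<in> state_set P (t - 1) \<and> valid_approx P t lo hi \<longrightarrow>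
        (let r = Or x lo hi; V = out_cut r; v = out_val r; y = out_state r in
           y \<in> state_set P t \<and>
           (\<exists>a b. V = (\<lambda>z. a \<bullet> z + b)) \<and>
           (\<forall>z z'. \<bar>V z - V z'\<bar> \<le> lip P t * nrm P (t - 1) (z - z')) \<and>
           v \<noteq> -\<infinity> \<and>
           (\<forall>z\<in>state_set P (t - 1). ereal (V z) \<le> enn2ereal (reg_cost_to_go P (t - 1) z)) \<and>
           enn2ereal (reg_cost_to_go P (t - 1) x) \<le> v \<and>
           v - ereal (V x) \<le> out_gap r \<and>
           out_gap r = hi y - ereal (lo y)))"

definition valid_oracles ::
  "('b, 'a::euclidean_space, 'm) problem \<Rightarrow> 'a init_oracle \<Rightarrow> (nat \<Rightarrow> 'a stage_oracle) \<Rightarrow> bool"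
where
  "valid_oracles P O1 Or \<longleftrightarrow>
     is_init_oracle P O1 \<and> (\<forall>t\<in>{2..horizon P}. is_stage_oracle P t (Or t))"


section \<open>The algorithms\<close>

text \<open>\<open>best\<close> is \<open>None\<close> until an incumbent solution has been recorded; \<open>evals\<close> counts the
  oracle evaluations.\<close>

record 'a run =
  low   :: "nat \<Rightarrow> 'a \<Rightarrow> real"
  upp   :: "nat \<Rightarrow> 'a \<Rightarrow> ereal"
  cur   :: "nat \<Rightarrow> 'a"
  lb    :: ereal
  ub    :: ereal
  best  :: "'a option"
  evals :: nat

record 'a nddp_run = "'a run" +
  stage  :: nat
  halted :: bool

definition refine_low :: "('a \<Rightarrow> real) \<Rightarrow> 'a stage_output \<Rightarrow> 'a \<Rightarrow> real" where
  "refine_low lo r = (\<lambda>y. max (lo y) (out_cut r y))"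

text \<open>\<open>r\<close> is an answer of the oracle of stage \<open>t\<close> at the state \<open>x\<close> of stage \<open>t - 1\<close>.\<close>

definition refine_upp ::
  "('b, 'a::real_inner, 'm) problem \<Rightarrow> nat \<Rightarrow> ('a \<Rightarrow> ereal) \<Rightarrow> 'a stage_output \<Rightarrow> 'a \<Rightarrow> 'a \<Rightarrow> ereal"
where
  "refine_upp P t hi r x =
     conv2 hi (\<lambda>y. out_val r + ereal (lip P t * nrm P (t - 1) (y - x)))"

definition init_low :: "nat \<Rightarrow> 'a \<Rightarrow> real" where
  "init_low t x = 0"

definition init_upp :: "('b, 'a, 'm) problem \<Rightarrow> nat \<Rightarrow> 'a \<Rightarrow> ereal" where
  "init_upp P t x = (if t < horizon P then \<infinity> else 0)"

definition eval_initial ::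
  "('b, 'a, 'm) problem \<Rightarrow> 'a init_oracle \<Rightarrow> ('a, 'z) run_scheme \<Rightarrow> ('a, 'z) run_scheme" where
  "eval_initial P O1 s =
     (let x = fst (O1 (low s 1) (upp s 1));
          ub' = enn2ereal (first_cost P x) + upp s 1 x
      in s\<lparr>cur := (cur s)(1 := x),
           lb := enn2ereal (first_cost P x) + ereal (low s 1 x),
           ub := (if ub' < ub s then ub' else ub s),
           best := (if ub' < ub s then Some x else best s),
           evals := evals s + 1\<rparr>)"

subsection \<open>CDDP\<close>

text \<open>With \<open>low = 0\<close> and \<open>upp = \<infinity>\<close> at stage 1, \<open>eval_initial\<close> sets \<open>lb\<close> to the first-stage cost
  and leaves \<open>ub = \<infinity>\<close> and \<open>best = None\<close>.\<close>

definition cddp_init :: "('b, 'a, 'm) problem \<Rightarrow> 'a init_oracle \<Rightarrow> 'a run" where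
  "cddp_init P O1 =
     eval_initial P O1
       \<lparr>low = init_low, upp = init_upp P, cur = (\<lambda>t. undefined),
        lb = 0, ub = \<infinity>, best = None, evals = 0\<rparr>"

fun trial_state :: "(nat \<Rightarrow> 'a stage_oracle) \<Rightarrow> 'a run \<Rightarrow> nat \<Rightarrow> 'a" where
  "trial_state Or s t =
     (if t \<le> 1 then cur s 1
      else out_state (Or t (trial_state Or s (t - 1)) (low s t) (upp s t)))"

declare trial_state.simps [simp del]

definition cddp_body ::
  "('b, 'a::real_inner, 'm) problem \<Rightarrow> 'a init_oracle \<Rightarrow> (nat \<Rightarrow> 'a stage_oracle) \<Rightarrow> 'a run \<Rightarrow> 'a run"
where
  "cddp_body P O1 Or s =
     (let x = trial_state Or s;
          r = (\<lambda>t. Or t (x (t - 1)) (low s t) (upp s t))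
      in eval_initial P O1
           (s\<lparr>low := (\<lambda>t. if t \<in> {1..<horizon P}
                          then refine_low (low s t) (r (t + 1)) else low s t),
              upp := (\<lambda>t. if t \<in> {1..<horizon P}
                          then refine_upp P (t + 1) (upp s t) (r (t + 1)) (x t) else upp s t),
              cur := x,
              evals := evals s + (horizon P - 1)\<rparr>))"

definition cddp ::
  "('b, 'a::real_inner, 'm) problem \<Rightarrow> 'a init_oracle \<Rightarrow> (nat \<Rightarrow> 'a stage_oracle) \<Rightarrow> real
     \<Rightarrow> 'a run option" where
  "cddp P O1 Or \<epsilon> =
     while_option (\<lambda>s. ub s - lb s > ereal \<epsilon>) (cddp_body P O1 Or) (cddp_init P O1)"

subsection \<open>NDDP\<close>

definition nddp_init :: "('b, 'a, 'm) problem \<Rightarrow> 'a nddp_run" where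
  "nddp_init P =
     \<lparr>low = init_low, upp = init_upp P, cur = (\<lambda>t. undefined),
      lb = 0, ub = \<infinity>, best = None, evals = 0, stage = 1, halted = False\<rparr>"

definition nddp_step ::
  "('b, 'a::real_inner, 'm) problem \<Rightarrow> 'a init_oracle \<Rightarrow> (nat \<Rightarrow> 'a stage_oracle) \<Rightarrow> (nat \<Rightarrow> real)
     \<Rightarrow> 'a nddp_run \<Rightarrow> 'a nddp_run" where
  "nddp_step P O1 Or \<delta> s =
     (if stage s = 1 then
        (let s' = eval_initial P O1 s
         in if ub s' - lb s' \<le> ereal (\<delta> 1) then s'\<lparr>halted := True\<rparr> else s'\<lparr>stage := 2\<rparr>)
      else
        (let t = stage s;
             x = cur s (t - 1);
             r = Or t x (low s t) (upp s t);
             s' = s\<lparr>cur := (cur s)(t := out_state r), evals := evals s + 1\<rparr>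
         in if t < horizon P \<and> out_gap r > ereal (\<delta> t) then s'\<lparr>stage := t + 1\<rparr>
            else s'\<lparr>low := (low s)(t - 1 := refine_low (low s (t - 1)) r),
                    upp := (upp s)(t - 1 := refine_upp P t (upp s (t - 1)) r x),
                    stage := t - 1\<rparr>))"

definition nddp ::
  "('b, 'a::real_inner, 'm) problem \<Rightarrow> 'a init_oracle \<Rightarrow> (nat \<Rightarrow> 'a stage_oracle) \<Rightarrow> (nat \<Rightarrow> real)
     \<Rightarrow> 'a nddp_run option" where
  "nddp P O1 Or \<delta> =
     while_option (\<lambda>s. \<not> halted s) (nddp_step P O1 Or \<delta>) (nddp_init P)"

definition gap_vector :: "nat \<Rightarrow> (nat \<Rightarrow> real) \<Rightarrow> bool" where
  "gap_vector T \<delta> \<longleftrightarrow> (\<forall>t\<in>{1..<T}. \<delta> (t + 1) < \<delta> t) \<and> \<delta> T = 0"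

end

theory Submission
  imports Defs
begin

text \<open>The proof charges oracle evaluations to states at which the gap between the upper and the lower
  approximation is closed, and bounds the number of these states by a packing argument.

  \<^bold>\<open>Soundness.\<close> The cost-to-go functions are convex and Lipschitz continuous on the state spaces
  (\<open>Q_convex_lsc\<close>), because minimization over a compact convex set, expectation and supremum preserve
  these properties. Hence, where finite, they are suprema of affine functions with the same Lipschitz constant
  (\<open>affine_minorant_approx\<close>), from which two facts follow. The regularized cost-to-go functions coincide
  with the original ones on the state spaces (\<open>reg_cost_to_go_eq\<close>). And the approximations stay
  on their sides of the cost-to-go functions when they are refined (\<open>sound_approx_refine\<close>): cones
  and convex hulls stay above all affine minorants. Therefore the bounds \<open>lb\<close> and \<open>ub\<close>
  enclose the optimal value.

  \<^bold>\<open>Counting.\<close> Let the tolerated gaps be \<open>\<delta> t = (T - t) * \<eta>\<close> with \<open>\<eta> = \<alpha> * C\<close>. Suppose that at a state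
  \<open>x\<close> of stage \<open>t\<close> the gap exceeds \<open>\<delta> t\<close>, and that the oracle of stage \<open>Suc t\<close> answers with a gap of at
  most \<open>\<delta> (Suc t)\<close>. After the update the gap at \<open>x\<close> is at most \<open>\<delta> (Suc t)\<close> and grows away from \<open>x\<close> with
  slope at most \<open>2 * M\<close> (\<open>gap_cone_refine\<close>), so it is at most \<open>\<delta> t\<close> within distance \<open>\<eta> / (2 * M)\<close> of
  \<open>x\<close>. Hence all such states of one stage are at least this distance apart (\<open>saturated_insert\<close>),
  and comparing volumes there are at most \<open>(1 + 2 * M * D / \<eta>) ^ DIM('a)\<close> of them
  (\<open>card_separated_le\<close>). Every iteration of CDDP, at the cost of \<open>T\<close> evaluations, produces such a state
  at some stage, because the gap at the trial states exceeds \<open>\<delta> 1\<close> at stage 1 and is 0 at stage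
  \<open>T\<close>. In NDDP every update produces one, and there is exactly one evaluation without an update
  for each evaluation with one, apart from the last evaluation.

  \<^bold>\<open>Relative gap.\<close> Each stage costs at least \<open>C\<close>, so the optimal value is at least \<open>T * C\<close>, and the
  final absolute gap \<open>\<delta> 1 = (T - 1) * \<alpha> * C\<close> is at most \<open>\<alpha>\<close> times the optimal value.\<close>

section \<open>Packing in a norm ball\<close>

lemma is_normD:
  assumes "is_norm N"
  shows is_norm_nonneg: "0 \<le> N x"
    and is_norm_zero: "N 0 = 0"
    and is_norm_eq_0: "N x = 0 \<longleftrightarrow> x = 0"
    and is_norm_scale: "N (c *\<^sub>R x) = \<bar>c\<bar> * N x"
    and is_norm_triangle: "N (x + y) \<le> N x + N y"
  using assms by (auto simp: is_norm_def)

lemma is_norm_minus: "is_norm N \<Longrightarrow> N (- x) = N x"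
  using is_norm_scale[of N "-1" x] by simp

lemma is_norm_commute: "is_norm N \<Longrightarrow> N (x - y) = N (y - x)"
  using is_norm_minus[of N "x - y"] by simp

lemma is_norm_triangle': "is_norm N \<Longrightarrow> N (x - z) \<le> N (x - y) + N (y - z)"
  using is_norm_triangle[of N "x - y" "y - z"] by simp

lemma is_norm_le_euclidean:
  fixes N :: "'a::euclidean_space \<Rightarrow> real"
  assumes N: "is_norm N"
  obtains K where "K > 0" "\<And>x. N x \<le> K * norm x"
proof
  let ?K = "1 + (\<Sum>b\<in>Basis. N b)"
  show "0 < ?K"
    using sum_nonneg[of Basis N] is_norm_nonneg[OF N] by (smt (verit))
  show "N x \<le> ?K * norm x" for x
  proof -
    have sum_le: "N (sum f B) \<le> (\<Sum>b\<in>B. N (f b))" if "finite B" for f :: "'a \<Rightarrow> 'a" and B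
      using that
    proof (induction rule: finite_induct)
      case (insert b B)
      then show ?case
        using is_norm_triangle[OF N, of "f b" "sum f B"] by simp
    qed (simp add: is_norm_zero[OF N])
    have "N x = N (\<Sum>b\<in>Basis. (x \<bullet> b) *\<^sub>R b)"
      by (simp add: euclidean_representation)
    also have "\<dots> \<le> (\<Sum>b\<in>Basis. N ((x \<bullet> b) *\<^sub>R b))"
      by (rule sum_le) simp
    also have "\<dots> \<le> (\<Sum>b\<in>Basis. norm x * N b)"
      by (rule sum_mono)
        (simp add: is_norm_scale[OF N] mult_right_mono Basis_le_norm is_norm_nonneg[OF N])
    also have "\<dots> \<le> ?K * norm x"
      by (simp only: sum_distrib_left[symmetric]) (simp add: distrib_right)
    finally show ?thesis .
  qed
qed

lemma continuous_on_is_norm: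
  fixes N :: "'a::euclidean_space \<Rightarrow> real"
  assumes N: "is_norm N"
  shows "continuous_on S N"
proof -
  obtain K where K: "K > 0" "\<And>x. N x \<le> K * norm x"
    using is_norm_le_euclidean[OF N] by blast
  have "\<bar>N x - N y\<bar> \<le> K * norm (x - y)" for x y
    using is_norm_triangle'[OF N, of x 0 y] is_norm_triangle'[OF N, of y 0 x]
      is_norm_commute[OF N, of x y] K(2)[of "x - y"] by simp
  then have "K-lipschitz_on S N"
    using K(1) by (intro lipschitz_onI) (auto simp: dist_norm)
  then show ?thesis
    by (rule lipschitz_on_continuous_on)
qed

lemma is_norm_ge_euclidean:
  fixes N :: "'a::euclidean_space \<Rightarrow> real"
  assumes N: "is_norm N"
  obtains c where "c > 0" "\<And>x. c * norm x \<le> N x"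
proof -
  have "compact (sphere (0::'a) 1)" "sphere (0::'a) 1 \<noteq> {}"
    by auto
  then obtain u where u: "u \<in> sphere 0 1" "\<And>x. x \<in> sphere 0 1 \<Longrightarrow> N u \<le> N x"
    using continuous_attains_inf[OF _ _ continuous_on_is_norm[OF N], of "sphere 0 1"] by metis
  show thesis
  proof
    have "u \<noteq> 0"
      using u(1) by auto
    then show "0 < N u"
      using is_norm_nonneg[OF N, of u] is_norm_eq_0[OF N, of u] by linarith
    show "N u * norm x \<le> N x" for x
    proof (cases "x = 0")
      case False
      then have "N u \<le> N (inverse (norm x) *\<^sub>R x)"
        by (intro u(2)) simp
      then show ?thesis
        using False by (simp add: is_norm_scale[OF N] field_simps)
    qed (simp add: is_norm_zero[OF N])
  qed
qed

text \<open>The volume argument: open norm balls of radius \<open>r / 2\<close> around the points are disjoint and lie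
  in one ball of radius \<open>(D + r) / 2\<close>, and volume scales with the power \<open>DIM('a)\<close> of the radius.\<close>

lemma card_separated_le:
  fixes N :: "'a::euclidean_space \<Rightarrow> real"
  assumes N: "is_norm N" and r: "r > 0" and A: "finite A" "A \<subseteq> norm_cball N c (D / 2)"
    and sep: "\<And>x y. x \<in> A \<Longrightarrow> y \<in> A \<Longrightarrow> x \<noteq> y \<Longrightarrow> r \<le> N (x - y)"
    and D: "0 \<le> D"
  shows "real (card A) \<le> (1 + D / r) ^ DIM('a)"
proof -
  define B where "B x s = {y. N (y - x) < s}" for x :: 'a and s :: real
  let ?d = "DIM('a)" and ?m = "measure lebesgue (B 0 1)"
  have open_B: "open (B x s)" for x s
    unfolding B_def
    by (intro open_Collect_less continuous_on_compose2[OF continuous_on_is_norm[OF N, of UNIV]]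
        continuous_intros) auto
  obtain k where k: "k > 0" "\<And>x. k * norm x \<le> N x"
    using is_norm_ge_euclidean[OF N] by blast
  have bounded_B: "bounded (B x s)" for x s
  proof (rule boundedI)
    fix y assume "y \<in> B x s"
    then have "k * norm (y - x) < s"
      using k(2)[of "y - x"] by (simp add: B_def)
    then have "norm (y - x) \<le> s / k"
      using k(1) by (simp add: field_simps)
    then show "norm y \<le> s / k + norm x"
      using norm_triangle_sub[of y x] by linarith
  qed
  have B_lmeas: "B x s \<in> lmeasurable" for x s
    using open_B bounded_B by (simp add: lmeasurable_open)
  have B_affine: "B x s = (\<lambda>y. s *\<^sub>R y + x) ` B 0 1" if "s > 0" for x s
  proof safe
    fix y assume y: "y \<in> B x s"
    have "N (inverse s *\<^sub>R (y - x)) < 1"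
      unfolding is_norm_scale[OF N] using y that by (simp add: B_def field_simps)
    then have "y = s *\<^sub>R (inverse s *\<^sub>R (y - x)) + x" "inverse s *\<^sub>R (y - x) \<in> B 0 1"
      using that by (simp_all add: B_def)
    then show "y \<in> (\<lambda>y. s *\<^sub>R y + x) ` B 0 1"
      by blast
  next
    fix y assume "y \<in> B 0 1"
    then show "s *\<^sub>R y + x \<in> B x s"
      using that by (simp add: B_def is_norm_scale[OF N])
  qed
  have vol: "measure lebesgue (B x s) = s ^ ?d * ?m" if "s > 0" for x s
    unfolding B_affine[OF that] using measure_lebesgue_affine[of s x "B 0 1"] that by simp
  have "0 \<in> B 0 1"
    by (simp add: B_def is_norm_zero[OF N])
  then have "\<not> negligible (B 0 1)"
    using open_not_negligible[OF open_B, of 0 1] by auto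
  then have m_pos: "?m > 0"
    using B_lmeas[of 0 1] by (metis measure_nonneg negligible_iff_measure order_le_less)
  have disj: "disjoint_family_on (\<lambda>x. B x (r / 2)) A"
    unfolding disjoint_family_on_def
  proof (intro ballI impI)
    fix x y assume xy: "x \<in> A" "y \<in> A" "x \<noteq> y"
    have False if "z \<in> B x (r / 2)" "z \<in> B y (r / 2)" for z
      using that sep[OF xy] is_norm_triangle'[OF N, of x y z] is_norm_commute[OF N, of x z]
      unfolding B_def by simp
    then show "B x (r / 2) \<inter> B y (r / 2) = {}"
      by blast
  qed
  have "real (card A) * ((r / 2) ^ ?d * ?m) = (\<Sum>x\<in>A. measure lebesgue (B x (r / 2)))"
    using r by (simp add: vol[of "r / 2"])
  also have "\<dots> = measure lebesgue (\<Union>x\<in>A. B x (r / 2))"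
    using A(1) B_lmeas disj
    by (intro measure_finite_Union[symmetric]) (simp_all add: fmeasurableD fmeasurableD2 image_subset_iff del: emeasure_completion)
  also have "\<dots> \<le> measure lebesgue (B c (D / 2 + r / 2))"
  proof (rule measure_mono_fmeasurable)
    show "(\<Union>x\<in>A. B x (r / 2)) \<subseteq> B c (D / 2 + r / 2)"
    proof
      fix y assume "y \<in> (\<Union>x\<in>A. B x (r / 2))"
      then obtain x where x: "x \<in> A" "N (y - x) < r / 2"
        by (auto simp: B_def)
      then have "N (x - c) \<le> D / 2"
        using A(2) by (auto simp: norm_cball_def)
      then show "y \<in> B c (D / 2 + r / 2)"
        using x(2) is_norm_triangle'[OF N, of y c x] by (simp add: B_def)
    qed
    show "(\<Union>x\<in>A. B x (r / 2)) \<in> sets lebesgue"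
      using A(1) B_lmeas by (intro sets.finite_UN) (auto simp: fmeasurable_def)
  qed (rule B_lmeas)
  also have "\<dots> = (D / 2 + r / 2) ^ ?d * ?m"
    using r D by (intro vol) simp
  finally have "real (card A) * (r / 2) ^ ?d \<le> (D / 2 + r / 2) ^ ?d"
    using m_pos by (simp add: mult.assoc[symmetric])
  also have "D / 2 + r / 2 = (1 + D / r) * (r / 2)"
    using r by (simp add: field_simps)
  finally show ?thesis
    unfolding power_mult_distrib using r by simp
qed


section \<open>Lower semicontinuity\<close>

lemma lsc_on_iff_openin:
  "lsc_on S g \<longleftrightarrow> (\<forall>c. openin (top_of_set S) {x\<in>S. c < g x})"
proof
  assume g: "lsc_on S g"
  show "\<forall>c. openin (top_of_set S) {x\<in>S. c < g x}"
  proof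
    fix c
    have "\<exists>T. openin (top_of_set S) T \<and> x \<in> T \<and> T \<subseteq> {x\<in>S. c < g x}"
      if "x \<in> {x\<in>S. c < g x}" for x
    proof -
      have "eventually (\<lambda>y. c < g y) (at x within S)"
        using g that by (auto simp: lsc_on_def)
      then obtain U where "open U" "x \<in> U" "\<forall>y\<in>U. y \<noteq> x \<longrightarrow> y \<in> S \<longrightarrow> c < g y"
        by (auto simp: eventually_at_topological)
      then show ?thesis
        using that by (intro exI[of _ "S \<inter> U"]) auto
    qed
    then show "openin (top_of_set S) {x\<in>S. c < g x}"
      by (subst openin_subopen) blast
  qed
next
  assume *: "\<forall>c. openin (top_of_set S) {x\<in>S. c < g x}"
  show "lsc_on S g"
    unfolding lsc_on_def
  proof (intro ballI allI impI)
    fix x c assume x: "x \<in> S" "c < g x"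
    obtain U where U: "open U" "{x\<in>S. c < g x} = S \<inter> U"
      using *[rule_format, of c] by (auto simp: openin_open)
    have "x \<in> U" "\<forall>y\<in>U. y \<in> S \<longrightarrow> c < g y"
      using U(2) x by blast+
    then show "eventually (\<lambda>y. c < g y) (at x within S)"
      using U(1) by (auto simp: eventually_at_topological)
  qed
qed

lemma lsc_on_compose:
  assumes g: "lsc_on S g" and h: "continuous_on S' h" "h ` S' \<subseteq> S"
  shows "lsc_on S' (\<lambda>x. g (h x))"
  unfolding lsc_on_iff_openin
proof
  fix c
  have "openin (top_of_set S') (S' \<inter> h -` {x\<in>S. c < g x})"
    using g h by (intro continuous_openin_preimage[of S' h S]) (auto simp: lsc_on_iff_openin)
  also have "S' \<inter> h -` {x\<in>S. c < g x} = {x\<in>S'. c < g (h x)}"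
    using h(2) by auto
  finally show "openin (top_of_set S') {x\<in>S'. c < g (h x)}" .
qed

text \<open>Splits a strict lower bound of a sum into strict lower bounds of the summands. The first
  two alternatives cover summands equal to 0, below which there is no value.\<close>

lemma less_add_ennreal_split:
  fixes a b c :: ennreal
  assumes "c < a + b"
  shows "c < a \<or> c < b \<or> (\<exists>a'<a. \<exists>b'<b. c < a' + b')"
proof (rule ccontr)
  assume *: "\<not> ?thesis"
  then have le: "a \<le> c" "b \<le> c"
    by auto
  have "c < top"
    using assms by (auto simp: less_top[symmetric])
  then obtain c' where c': "c = ennreal c'" "c' \<ge> 0"
    by (cases c) auto
  from le obtain a' b' where a': "a = ennreal a'" "a' \<ge> 0" and b': "b = ennreal b'" "b' \<ge> 0"
    using \<open>c < top\<close> by (cases a; cases b) (auto simp: top_unique)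
  \<comment> \<open>Lowering both summands by a third of the excess \<open>a' + b' - c'\<close> leaves a sum above \<open>c'\<close>.\<close>
  define m where "m = (a' + b' - c') / 3"
  have "c' < a' + b'" "a' \<le> c'" "b' \<le> c'"
    using assms le unfolding c' a' b'
    by (auto simp: ennreal_plus[symmetric] ennreal_less_iff a' b' c' simp del: ennreal_plus)
  moreover have "3 * m = a' + b' - c'"
    by (simp add: m_def)
  ultimately have "0 < m" "0 \<le> a' - m" "0 \<le> b' - m" "c' < (a' - m) + (b' - m)"
    using a'(2) b'(2) by linarith+
  then have "ennreal (a' - m) < a" "ennreal (b' - m) < b" "c < ennreal (a' - m) + ennreal (b' - m)"
    unfolding a' b' c'
    by (auto simp: ennreal_plus[symmetric] ennreal_less_iff c' simp del: ennreal_plus)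
  then show False
    using * by blast
qed

lemma lsc_on_add_ennreal:
  fixes f g :: "_ \<Rightarrow> ennreal"
  assumes "lsc_on S f" "lsc_on S g"
  shows "lsc_on S (\<lambda>x. f x + g x)"
  unfolding lsc_on_def
proof (intro ballI allI impI)
  fix x c assume x: "x \<in> S" and c: "c < f x + g x"
  consider "c < f x" | "c < g x" | a' b' where "a' < f x" "b' < g x" "c < a' + b'"
    using less_add_ennreal_split[OF c] by blast
  then show "eventually (\<lambda>y. c < f y + g y) (at x within S)"
  proof cases
    case 1
    then have "eventually (\<lambda>y. c < f y) (at x within S)"
      using assms(1) x by (auto simp: lsc_on_def)
    then show ?thesis
      by eventually_elim (metis add.right_neutral add_left_mono order_less_le_trans zero_le)
  next
    case 2
    then have "eventually (\<lambda>y. c < g y) (at x within S)"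
      using assms(2) x by (auto simp: lsc_on_def)
    then show ?thesis
      by eventually_elim (metis add.left_neutral add_right_mono order_less_le_trans zero_le)
  next
    case 3
    then have "eventually (\<lambda>y. a' < f y) (at x within S)" "eventually (\<lambda>y. b' < g y) (at x within S)"
      using assms x by (auto simp: lsc_on_def)
    then show ?thesis
      by eventually_elim (metis 3(3) add_mono less_imp_le order_less_le_trans)
  qed
qed

text \<open>Compactness makes the minimum stable: finitely many of the neighbourhoods on which
  \<open>F\<close> stays above \<open>c\<close> cover the compact factor.\<close>

lemma lsc_on_INF_compact:
  fixes F :: "'a::topological_space \<Rightarrow> 'm::topological_space \<Rightarrow> ennreal"
  assumes K: "compact K" and F: "lsc_on (K \<times> S) (\<lambda>(y, w). F y w)"
  shows "lsc_on S (\<lambda>w. INF y\<in>K. F y w)"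
  unfolding lsc_on_def
proof (intro ballI allI impI)
  fix w c assume w: "w \<in> S" and c: "c < (INF y\<in>K. F y w)"
  obtain c' where c': "c < c'" "c' < (INF y\<in>K. F y w)"
    using dense[OF c] by blast
  obtain G where G: "open G" "{x\<in>K \<times> S. c' < (case x of (y, w) \<Rightarrow> F y w)} = (K \<times> S) \<inter> G"
    using F unfolding lsc_on_iff_openin openin_open by metis
  have "\<exists>U W. open U \<and> open W \<and> y \<in> U \<and> w \<in> W \<and> U \<times> W \<subseteq> G" if "y \<in> K" for y
  proof -
    have "c' < F y w"
      using c'(2) that by (meson INF_lower order_less_le_trans)
    then have "(y, w) \<in> {x\<in>K \<times> S. c' < (case x of (y, w) \<Rightarrow> F y w)}"
      using that w by simp
    then have "(y, w) \<in> G"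
      unfolding G(2) by simp
    then show ?thesis
      using G(1) unfolding open_prod_def by (elim ballE[of _ _ "(y, w)"]) (auto simp: mem_Times_iff)
  qed
  then obtain U W where UW: "\<And>y. y \<in> K \<Longrightarrow> open (U y) \<and> open (W y) \<and> y \<in> U y \<and> w \<in> W y \<and> U y \<times> W y \<subseteq> G"
    by metis
  obtain Y where Y: "Y \<subseteq> K" "finite Y" "K \<subseteq> (\<Union>y\<in>Y. U y)"
    using compactE_image[OF K, of K U] UW by blast
  define V where "V = (\<Inter>y\<in>Y. W y)"
  have V: "open V" "w \<in> V"
    using Y UW by (auto simp: V_def intro!: open_INT)
  have "c < (INF y\<in>K. F y w')" if "w' \<in> V" "w' \<in> S" for w'
  proof -
    have "c' \<le> F y w'" if y: "y \<in> K" for y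
    proof -
      obtain y0 where "y0 \<in> Y" "y \<in> U y0"
        using subsetD[OF Y(3) y] by blast
      then have "(y, w') \<in> U y0 \<times> W y0" "y0 \<in> K"
        using Y(1) \<open>w' \<in> V\<close> by (auto simp: V_def)
      then have "(y, w') \<in> G"
        using UW by blast
      then have "(y, w') \<in> (K \<times> S) \<inter> G"
        using that \<open>w' \<in> S\<close> by simp
      then show ?thesis
        unfolding G(2)[symmetric] by (simp add: less_imp_le)
    qed
    then show ?thesis
      using c'(1) by (meson INF_greatest order_less_le_trans)
  qed
  then show "eventually (\<lambda>w. c < (INF y\<in>K. F y w)) (at w within S)"
    using V by (auto simp: eventually_at_topological)
qed

lemma borel_measurable_lsc_on:
  fixes g :: "'m::topological_space \<Rightarrow> ennreal"
  assumes "lsc_on S g"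
  shows "g \<in> borel_measurable (restrict_space borel S)"
proof (rule borel_measurableI_greater)
  fix c
  obtain U where "open U" "{x\<in>S. c < g x} = S \<inter> U"
    using assms unfolding lsc_on_iff_openin openin_open by metis
  moreover have "{x\<in>space (restrict_space borel S). c < g x} = {x\<in>S. c < g x}"
    by (simp add: space_restrict_space)
  ultimately show "{x\<in>space (restrict_space borel S). c < g x} \<in> sets (restrict_space borel S)"
    by (auto simp: sets_restrict_space)
qed


section \<open>Convexity and affine minorants\<close>

text \<open>Convexity on a set of functions into \<open>[0, \<infinity>]\<close>, with the convention \<open>0 * \<infinity> = 0\<close>.\<close>

definition ennreal_convex_on :: "'a::real_vector set \<Rightarrow> ('a \<Rightarrow> ennreal) \<Rightarrow> bool" where
  "ennreal_convex_on S g \<longleftrightarrow>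
     (\<forall>x\<in>S. \<forall>y\<in>S. \<forall>u\<ge>0. \<forall>v\<ge>0. u + v = 1 \<longrightarrow>
        g (u *\<^sub>R x + v *\<^sub>R y) \<le> ennreal u * g x + ennreal v * g y)"

text \<open>Lipschitz continuity with respect to \<open>N\<close>, stated without subtraction so that it extends to
  functions that are infinite on all of \<open>X\<close>.\<close>

definition ennreal_lipschitz_on :: "'a::real_vector set \<Rightarrow> ('a \<Rightarrow> real) \<Rightarrow> real \<Rightarrow> ('a \<Rightarrow> ennreal) \<Rightarrow> bool" where
  "ennreal_lipschitz_on X N L g \<longleftrightarrow> (\<forall>x\<in>X. \<forall>y\<in>X. g x \<le> g y + ennreal (L * N (x - y)))"

lemma ennreal_lipschitz_onD:
  "ennreal_lipschitz_on X N L g \<Longrightarrow> x \<in> X \<Longrightarrow> y \<in> X \<Longrightarrow> g x \<le> g y + ennreal (L * N (x - y))"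
  by (auto simp: ennreal_lipschitz_on_def)

lemma ennreal_lipschitz_on_finite:
  assumes "ennreal_lipschitz_on X N L g" "x \<in> X" "y \<in> X" "g x < \<infinity>"
  shows "g y < \<infinity>"
  using ennreal_lipschitz_onD[OF assms(1,3,2)] assms(4)
  by (auto simp: order_le_less_trans)

lemma ennreal_lipschitz_on_enn2real:
  assumes N: "is_norm N" and L: "0 \<le> L" and g: "ennreal_lipschitz_on X N L g"
    and x: "x \<in> X" "y \<in> X" "g y < \<infinity>"
  shows "enn2real (g x) \<le> enn2real (g y) + L * N (x - y)"
proof -
  have "enn2real (g x) \<le> enn2real (g y + ennreal (L * N (x - y)))"
    using ennreal_lipschitz_onD[OF g x(1,2)] x(3) by (intro enn2real_mono) auto
  also have "\<dots> = enn2real (g y) + L * N (x - y)"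
    using x(3) L is_norm_nonneg[OF N] by (subst enn2real_plus) auto
  finally show ?thesis .
qed

lemma lsc_on_ennreal_lipschitz:
  fixes N :: "'a::euclidean_space \<Rightarrow> real"
  assumes N: "is_norm N" and L: "0 \<le> L" and g: "ennreal_lipschitz_on X N L g"
  shows "lsc_on X g"
  unfolding lsc_on_def
proof (intro ballI allI impI)
  fix x c assume x: "x \<in> X" and c: "c < g x"
  obtain c' where c': "c < c'" "c' < g x"
    using dense[OF c] by blast
  then obtain a b where ab: "c = ennreal a" "a \<ge> 0" "c' = ennreal b" "b \<ge> 0" "a < b"
    by (cases c; cases c') (auto simp: ennreal_less_iff)
  have "((\<lambda>y. L * N (x - y)) \<longlongrightarrow> L * N (x - x)) (at x within X)"
    by (intro tendsto_intros continuous_on_tendsto_compose[OF continuous_on_is_norm[OF N, of UNIV]])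
      auto
  then have "eventually (\<lambda>y. L * N (x - y) < b - a) (at x within X)"
    using ab by (intro order_tendstoD(2)) (auto simp: is_norm_zero[OF N])
  moreover have "eventually (\<lambda>y. y \<in> X) (at x within X)"
    by (auto simp: eventually_at_filter)
  ultimately show "eventually (\<lambda>y. c < g y) (at x within X)"
  proof eventually_elim
    case (elim y)
    show ?case
    proof (rule ccontr)
      assume "\<not> c < g y"
      then have "g x \<le> c + ennreal (L * N (x - y))"
        using ennreal_lipschitz_onD[OF g x elim(2)] by (meson add_right_mono leI order_trans)
      also have "\<dots> = ennreal (a + L * N (x - y))"
        using ab L is_norm_nonneg[OF N] by (simp add: ennreal_plus[symmetric] del: ennreal_plus)
      also have "\<dots> \<le> c'"
        using elim ab by (auto intro!: ennreal_leI)
      finally show False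
        using c'(2) by simp
    qed
  qed
qed

text \<open>A subgradient comes from separating the strict epigraph from the point \<open>(x, g x)\<close> of the
  graph; the separating hyperplane is not vertical because \<open>g\<close> is finite around \<open>x\<close>. As \<open>g\<close> is
  \<open>L\<close>-Lipschitz near \<open>x\<close>, the dual norm of the subgradient is at most \<open>L\<close>.\<close>

lemma subgradient_exists:
  fixes g :: "'a::euclidean_space \<Rightarrow> ennreal"
  assumes S: "convex S" and g: "ennreal_convex_on S g" and X: "X \<subseteq> S" and x: "x \<in> interior X"
    and N: "is_norm N" and L: "0 \<le> L" and lip: "ennreal_lipschitz_on X N L g" and fin: "g x < \<infinity>"
  obtains l where "\<And>u. l \<bullet> u \<le> L * N u"
    and "\<And>z. z \<in> S \<Longrightarrow> ereal (enn2real (g x) + l \<bullet> (z - x)) \<le> enn2ereal (g z)"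
proof -
  define E where "E = {(z, s). z \<in> S \<and> g z < ennreal s}"
  have xX: "x \<in> X"
    using x interior_subset by blast
  have finX: "g z < \<infinity>" if "z \<in> X" for z
    using ennreal_lipschitz_on_finite[OF lip xX that fin] .
  have E_I: "(z, s) \<in> E" if "z \<in> S" "g z < \<infinity>" "enn2real (g z) < s" for z s
    using that by (cases "g z") (auto simp: E_def ennreal_less_iff)
  have "convex E"
    unfolding convex_def
  proof (intro ballI allI impI)
    fix p q and u v :: real assume pq: "p \<in> E" "q \<in> E" and uv: "0 \<le> u" "0 \<le> v" "u + v = 1"
    obtain y s z r where yz: "p = (y, s)" "q = (z, r)"
      by fastforce
    have yS: "y \<in> S" "z \<in> S" and less: "g y < ennreal s" "g z < ennreal r"
      using pq by (auto simp: E_def yz)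
    then obtain a b where ab: "g y = ennreal a" "0 \<le> a" "a < s" "g z = ennreal b" "0 \<le> b" "b < r"
      by (cases "g y"; cases "g z") (auto simp: ennreal_less_iff)
    have "g (u *\<^sub>R y + v *\<^sub>R z) \<le> ennreal u * g y + ennreal v * g z"
      using g yS uv by (auto simp: ennreal_convex_on_def)
    also have "\<dots> = ennreal (u * a + v * b)"
      using ab uv by (simp add: ennreal_mult[symmetric] ennreal_plus[symmetric] del: ennreal_plus)
    also have "\<dots> < ennreal (u * s + v * r)"
    proof -
      have "u * a + v * b < u * s + v * r"
        using ab uv by (cases "u = 0") (auto intro!: add_less_le_mono mult_left_mono)
      then show ?thesis
        using ab uv by (simp add: ennreal_less_iff del: ennreal_plus)
    qed
    finally show "u *\<^sub>R p + v *\<^sub>R q \<in> E"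
      using convexD[OF S yS uv] by (auto simp: E_def yz)
  qed
  moreover have "(x, enn2real (g x)) \<notin> E"
    using fin by (auto simp: E_def ennreal_enn2real_if)
  moreover have "(x, enn2real (g x) + 1) \<in> E"
    using E_I[of x] fin xX X by auto
  ultimately have "\<exists>a b. a \<noteq> 0 \<and> (\<forall>p\<in>{(x, enn2real (g x))}. a \<bullet> p \<le> b) \<and> (\<forall>p\<in>E. b \<le> a \<bullet> p)"
    by (intro separating_hyperplane_sets) auto
  then obtain a b where a: "a \<noteq> 0" "a \<bullet> (x, enn2real (g x)) \<le> b"
    "\<And>p. p \<in> E \<Longrightarrow> b \<le> a \<bullet> p"
    by blast
  obtain p q where pq: "a = (p, q)"
    by fastforce
  have sep: "p \<bullet> x + q * enn2real (g x) \<le> p \<bullet> z + q * s" if "(z, s) \<in> E" for z s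
    using a(2) a(3)[OF that] by (simp add: pq inner_prod_def)
  obtain e where e: "e > 0" "ball x e \<subseteq> X"
    using x mem_interior by blast
  have q_nonneg: "0 \<le> q"
    using sep[of x "enn2real (g x) + 1"] E_I[of x] fin xX X by (auto simp: algebra_simps)
  have "q \<noteq> 0"
  proof
    assume q: "q = 0"
    then have p: "p \<noteq> 0"
      using a(1) pq by (simp add: zero_prod_def)
    \<comment> \<open>A vertical hyperplane would cut the domain at \<open>x\<close>, but a step against \<open>p\<close> stays inside \<open>X\<close>.\<close>
    define z where "z = x - (e / (2 * norm p)) *\<^sub>R p"
    have "z \<in> ball x e"
      using p e by (simp add: z_def dist_norm)
    then have "z \<in> X"
      using e by blast
    then have "(z, enn2real (g z) + 1) \<in> E"
      using X finX by (intro E_I) auto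
    then have "p \<bullet> x \<le> p \<bullet> z"
      using sep q by fastforce
    moreover have "p \<bullet> z = p \<bullet> x - (e / (2 * norm p)) * (norm p)\<^sup>2"
      by (simp add: z_def inner_diff_right power2_norm_eq_inner)
    moreover have "0 < (e / (2 * norm p)) * (norm p)\<^sup>2"
      using p e by simp
    ultimately show False
      by linarith
  qed
  with q_nonneg have q: "q > 0"
    by simp
  define l where "l = - (1 / q) *\<^sub>R p"
  have above: "enn2real (g x) + l \<bullet> (z - x) \<le> s" if "(z, s) \<in> E" for z s
  proof -
    have "q * enn2real (g x) + p \<bullet> x - p \<bullet> z \<le> q * s"
      using sep[OF that] by simp
    then have "(q * enn2real (g x) + p \<bullet> x - p \<bullet> z) / q \<le> s"
      using q by (simp add: field_simps)
    then show ?thesis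
      using q by (simp add: l_def inner_diff_right field_simps)
  qed
  have subgrad: "enn2real (g x) + l \<bullet> (z - x) \<le> enn2real (g z)" if "z \<in> S" "g z < \<infinity>" for z
    by (rule dense_ge) (auto intro!: above E_I that)
  show thesis
  proof
    show "ereal (enn2real (g x) + l \<bullet> (z - x)) \<le> enn2ereal (g z)" if "z \<in> S" for z
      using subgrad[OF that] by (cases "g z") auto
    show "l \<bullet> u \<le> L * N u" for u
    proof (cases "u = 0")
      case False
      define t where "t = e / (2 * norm u)"
      have t: "t > 0" "x + t *\<^sub>R u \<in> ball x e"
        using False e by (auto simp: t_def dist_norm)
      then have tX: "x + t *\<^sub>R u \<in> X"
        using e by blast
      have "l \<bullet> (t *\<^sub>R u) \<le> enn2real (g (x + t *\<^sub>R u)) - enn2real (g x)"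
        using subgrad[of "x + t *\<^sub>R u"] tX X finX by auto
      also have "\<dots> \<le> L * N (t *\<^sub>R u)"
        using ennreal_lipschitz_on_enn2real[OF N L lip tX xX fin] by simp
      finally have "t * (l \<bullet> u) \<le> t * (L * N u)"
        using t by (simp add: is_norm_scale[OF N] mult_ac)
      then show ?thesis
        using t by simp
    qed (simp add: is_norm_zero[OF N])
  qed
qed

text \<open>At a boundary point \<open>x\<close>, the supporting affine functions at nearby interior points come
  arbitrarily close to \<open>g x\<close>, since their slopes are bounded by \<open>L\<close>.\<close>

lemma affine_minorant_approx:
  fixes g :: "'a::euclidean_space \<Rightarrow> ennreal"
  assumes S: "convex S" and g: "ennreal_convex_on S g" and X: "X \<subseteq> S" "convex X"
    and full: "interior X \<noteq> {}" and x: "x \<in> X"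
    and N: "is_norm N" and L: "0 \<le> L" and lip: "ennreal_lipschitz_on X N L g" and fin: "g x < \<infinity>"
    and e: "e > 0"
  obtains l b where "\<And>u. l \<bullet> u \<le> L * N u" "\<And>z. z \<in> S \<Longrightarrow> ereal (l \<bullet> z + b) \<le> enn2ereal (g z)"
    "enn2real (g x) - e \<le> l \<bullet> x + b"
proof -
  obtain K where K: "K > 0" "\<And>x. N x \<le> K * norm x"
    using is_norm_le_euclidean[OF N] by blast
  \<comment> \<open>Within Euclidean distance \<open>r\<close> of \<open>x\<close>, the function and its minorant each change by at most \<open>e / 2\<close>.\<close>
  define r where "r = e / (2 * (L * K + 1))"
  have LK: "0 < L * K + 1"
    using L K by (simp add: add_nonneg_pos)
  then have r: "r > 0"
    using e by (simp add: r_def)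
  have "x \<in> closure (interior X)"
    using convex_closure_interior[OF X(2) full] x closure_subset by blast
  then obtain y where y: "y \<in> interior X" "dist y x < r"
    using closure_approachable r by blast
  have yX: "y \<in> X"
    using y interior_subset by blast
  have fy: "g y < \<infinity>"
    using ennreal_lipschitz_on_finite[OF lip x yX fin] .
  obtain l where l: "\<And>u. l \<bullet> u \<le> L * N u"
    "\<And>z. z \<in> S \<Longrightarrow> ereal (enn2real (g y) + l \<bullet> (z - y)) \<le> enn2ereal (g z)"
    using subgradient_exists[OF S g X(1) y(1) N L lip fy] by blast
  have "L * N (x - y) \<le> L * (K * norm (x - y))"
    by (intro mult_left_mono K L)
  also have "\<dots> \<le> (L * K + 1) * norm (x - y)"
    by (simp add: distrib_right)
  also have "\<dots> \<le> (L * K + 1) * r"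
    using y LK by (intro mult_left_mono) (auto simp: dist_norm norm_minus_commute)
  also have "\<dots> = e / 2"
    using LK unfolding r_def by (metis less_numeral_extra(3) mult.commute nonzero_mult_divide_mult_cancel_right times_divide_eq_right)
  finally have small: "L * N (x - y) \<le> e / 2" .
  have "l \<bullet> (y - x) \<le> L * N (x - y)"
    using l(1)[of "y - x"] is_norm_commute[OF N, of x y] by simp
  moreover have "enn2real (g x) \<le> enn2real (g y) + L * N (x - y)"
    using ennreal_lipschitz_on_enn2real[OF N L lip x yX fy] .
  ultimately have "enn2real (g x) - e \<le> l \<bullet> x + (enn2real (g y) - l \<bullet> y)"
    using small by (simp add: inner_diff_right)
  moreover have "ereal (l \<bullet> z + (enn2real (g y) - l \<bullet> y)) \<le> enn2ereal (g z)" if "z \<in> S" for z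
    using l(2)[OF that] by (simp add: inner_diff_right algebra_simps)
  ultimately show thesis
    using l(1) that by blast
qed

text \<open>The slopes of the minorants above are admissible multipliers in the regularization.\<close>

lemma dual_norm_le:
  assumes N: "is_norm N" and M: "0 \<le> M" and l: "\<And>u. l \<bullet> u \<le> M * N u"
  shows "dual_norm N l \<le> M"
  unfolding dual_norm_def
proof (rule cSUP_least)
  show "{x. N x \<le> 1} \<noteq> {}"
    using is_norm_zero[OF N] by (auto intro!: exI[of _ 0])
  show "l \<bullet> x \<le> M" if "x \<in> {x. N x \<le> 1}" for x
    using l[of x] that mult_left_mono[of "N x" 1 M] M by simp
qed


lemma convex_on_max:
  assumes "convex_on S f" "convex_on S g"
  shows "convex_on S (\<lambda>x. max (f x) (g x))"
  unfolding convex_on_def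
proof (intro conjI ballI allI impI)
  show "convex S"
    using assms(1) by (simp add: convex_on_def)
  fix x y and u v :: real assume *: "x \<in> S" "y \<in> S" "0 \<le> u" "0 \<le> v" "u + v = 1"
  have "f (u *\<^sub>R x + v *\<^sub>R y) \<le> u * f x + v * f y" "g (u *\<^sub>R x + v *\<^sub>R y) \<le> u * g x + v * g y"
    using assms * by (auto simp: convex_on_def)
  moreover have "u * f x + v * f y \<le> u * max (f x) (g x) + v * max (f y) (g y)"
    "u * g x + v * g y \<le> u * max (f x) (g x) + v * max (f y) (g y)"
    using * by (auto intro!: add_mono mult_left_mono)
  ultimately show "max (f (u *\<^sub>R x + v *\<^sub>R y)) (g (u *\<^sub>R x + v *\<^sub>R y))
      \<le> u * max (f x) (g x) + v * max (f y) (g y)"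
    by linarith
qed


section \<open>The convex hull of two functions\<close>

lemma conv2_le:
  "conv2 g h x \<le> g x" "conv2 g h x \<le> h x"
proof -
  have "conv2 g h x \<le> min (g x) (h x)"
    unfolding conv2_def
  proof (rule SUP_least)
    fix l :: 'a
    show "(INF z. min (g z) (h z) + ereal (l \<bullet> (x - z))) \<le> min (g x) (h x)"
      by (rule INF_lower2[of x]) auto
  qed
  then show "conv2 g h x \<le> g x" "conv2 g h x \<le> h x"
    by auto
qed

text \<open>By construction the hull is a supremum of affine functions, hence above every common affine
  minorant.\<close>

lemma affine_le_conv2:
  assumes "\<And>z. ereal (l \<bullet> z + b) \<le> g z" "\<And>z. ereal (l \<bullet> z + b) \<le> h z"
  shows "ereal (l \<bullet> x + b) \<le> conv2 g h x"
  unfolding conv2_def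
proof (rule SUP_upper2[of l], simp, rule INF_greatest)
  fix z
  have "ereal (l \<bullet> x + b) = ereal (l \<bullet> z + b) + ereal (l \<bullet> (x - z))"
    by (simp add: inner_diff_right)
  also have "\<dots> \<le> min (g z) (h z) + ereal (l \<bullet> (x - z))"
    using assms by (intro add_right_mono) auto
  finally show "ereal (l \<bullet> x + b) \<le> min (g z) (h z) + ereal (l \<bullet> (x - z))" .
qed

lemma conv2_nonneg:
  assumes "\<And>z. 0 \<le> g z" "\<And>z. 0 \<le> h z"
  shows "0 \<le> conv2 g h x"
  using affine_le_conv2[of 0 0 g h x] assms by (simp add: zero_ereal_def)

text \<open>For each slope \<open>l\<close>, the function of \<open>x\<close> whose supremum over \<open>l\<close> is the hull. By the shift
  identity it is affine with slope \<open>l\<close>, or constantly infinite, so the hull inherits lower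
  semicontinuity and convexity.\<close>

definition conv2_term :: "('a::real_inner \<Rightarrow> ereal) \<Rightarrow> ('a \<Rightarrow> ereal) \<Rightarrow> 'a \<Rightarrow> 'a \<Rightarrow> ereal" where
  "conv2_term g h l x = (INF z. min (g z) (h z) + ereal (l \<bullet> (x - z)))"

lemma conv2_term_shift:
  "conv2_term g h l y = conv2_term g h l x + ereal (l \<bullet> (y - x))"
proof -
  have "conv2_term g h l y \<le> conv2_term g h l x + ereal (l \<bullet> (y - x))" for x y
  proof -
    have "conv2_term g h l y + ereal (l \<bullet> (x - y)) \<le> conv2_term g h l x"
      unfolding conv2_term_def
    proof (rule INF_greatest)
      fix z
      have "(INF z. min (g z) (h z) + ereal (l \<bullet> (y - z))) + ereal (l \<bullet> (x - y))
          \<le> (min (g z) (h z) + ereal (l \<bullet> (y - z))) + ereal (l \<bullet> (x - y))"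
        by (intro add_right_mono INF_lower) simp
      also have "\<dots> = min (g z) (h z) + ereal (l \<bullet> (x - z))"
        by (simp add: add.assoc inner_diff_right)
      finally show "(INF z. min (g z) (h z) + ereal (l \<bullet> (y - z))) + ereal (l \<bullet> (x - y))
          \<le> min (g z) (h z) + ereal (l \<bullet> (x - z))" .
    qed
    then have "conv2_term g h l y + ereal (l \<bullet> (x - y)) + ereal (l \<bullet> (y - x))
        \<le> conv2_term g h l x + ereal (l \<bullet> (y - x))"
      by (rule add_right_mono)
    then show ?thesis
      by (simp add: add.assoc inner_diff_right zero_ereal_def[symmetric])
  qed
  from this[of y x] this[of x y] show ?thesis
    by (cases "conv2_term g h l x"; cases "conv2_term g h l y") (auto simp: inner_diff_right)
qed

lemma conv2_eq_SUP: "conv2 g h x = (SUP l. conv2_term g h l x)"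
  by (simp add: conv2_def conv2_term_def)

lemma lsc_on_conv2: "lsc_on UNIV (conv2 g h)"
  unfolding lsc_on_def
proof (intro ballI allI impI)
  fix x c assume "c < conv2 g h x"
  then obtain l where l: "c < conv2_term g h l x"
    by (auto simp: conv2_eq_SUP less_SUP_iff)
  have "((\<lambda>y. l \<bullet> (y - x)) \<longlongrightarrow> l \<bullet> (x - x)) (at x)"
    by (intro tendsto_intros)
  then have lim: "((\<lambda>y. ereal (l \<bullet> (y - x))) \<longlongrightarrow> ereal 0) (at x)"
    by simp
  have "eventually (\<lambda>y. c < conv2_term g h l x + ereal (l \<bullet> (y - x))) (at x)"
  proof (cases "conv2_term g h l x")
    case (real r)
    have "((\<lambda>y. ereal r + ereal (l \<bullet> (y - x))) \<longlongrightarrow> ereal r + ereal 0) (at x)"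
      by (intro tendsto_add_ereal tendsto_const lim) auto
    then show ?thesis
      using l real by (intro order_tendstoD(1)) auto
  qed (use l in auto)
  then show "eventually (\<lambda>y. c < conv2 g h y) (at x)"
  proof eventually_elim
    case (elim y)
    then have "c < conv2_term g h l y"
      by (simp add: conv2_term_shift[of g h l y x])
    then show ?case
      unfolding conv2_eq_SUP by (rule less_le_trans) (rule SUP_upper, simp)
  qed
qed

lemma ext_convex_conv2:
  fixes g h :: "'a::real_inner \<Rightarrow> ereal"
  assumes nonneg: "\<And>z. 0 \<le> g z" "\<And>z. 0 \<le> h z"
  shows "ext_convex (conv2 g h)"
  unfolding ext_convex_def
proof (intro allI impI)
  fix x y :: 'a and u v :: real assume uv: "0 \<le> u" "0 \<le> v" "u + v = 1"
  let ?c = "conv2 g h" and ?p = "u *\<^sub>R x + v *\<^sub>R y"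
  have nn: "0 \<le> ?c z" for z
    by (rule conv2_nonneg[OF nonneg])
  show "?c ?p \<le> ereal u * ?c x + ereal v * ?c y"
  proof (cases "u = 0 \<or> v = 0")
    case True
    then show ?thesis
      using uv by (auto simp: one_ereal_def[symmetric] zero_ereal_def[symmetric])
  next
    case False
    then have uv': "u > 0" "v > 0"
      using uv by auto
    show ?thesis
    proof (cases "?c x = \<infinity> \<or> ?c y = \<infinity>")
      case True
      then show ?thesis
        using uv' nn[of x] nn[of y] by auto
    next
      case False
      then obtain A B where A: "?c x = ereal A" and B: "?c y = ereal B"
        using nn[of x] nn[of y] by (cases "?c x"; cases "?c y") auto
      have "conv2_term g h l ?p \<le> ereal (u * A + v * B)" for l
      proof -
        have "conv2_term g h l x \<le> ereal A" "conv2_term g h l y \<le> ereal B"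
          unfolding A[symmetric] B[symmetric] conv2_eq_SUP by (auto intro: SUP_upper)
        then have le: "conv2_term g h l ?p \<le> ereal (A + l \<bullet> (?p - x))"
            "conv2_term g h l ?p \<le> ereal (B + l \<bullet> (?p - y))"
          using add_right_mono[of "conv2_term g h l x" "ereal A" "ereal (l \<bullet> (?p - x))"]
            add_right_mono[of "conv2_term g h l y" "ereal B" "ereal (l \<bullet> (?p - y))"]
          by (simp_all add: conv2_term_shift[of g h l ?p x, symmetric]
              conv2_term_shift[of g h l ?p y, symmetric])
        show ?thesis
        proof (cases "conv2_term g h l ?p")
          case (real r)
          have "u * r + v * r \<le> u * (A + l \<bullet> (?p - x)) + v * (B + l \<bullet> (?p - y))"
            using le uv by (intro add_mono mult_left_mono) (auto simp: real)
          also have "\<dots> = u * A + v * B + ((u + v) * (l \<bullet> ?p) - l \<bullet> ?p)"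
            by (simp add: inner_diff_right inner_add_right algebra_simps)
          finally show ?thesis
            using uv by (simp add: real distrib_right[symmetric])
        qed (use le in auto)
      qed
      then show ?thesis
        by (simp add: A B) (simp add: conv2_eq_SUP SUP_least)
    qed
  qed
qed


section \<open>Cost-to-go functions\<close>

text \<open>Partial minimization of a jointly convex function, by combining near-optimal points.\<close>

lemma ennreal_convex_on_INF:
  fixes F :: "'a::real_vector \<Rightarrow> 'c::real_vector \<Rightarrow> ennreal"
  assumes K: "convex K"
    and F: "\<And>x x' y y' u v. x \<in> S \<Longrightarrow> x' \<in> S \<Longrightarrow> y \<in> K \<Longrightarrow> y' \<in> K \<Longrightarrow> 0 \<le> u \<Longrightarrow> 0 \<le> v \<Longrightarrow>
      u + v = 1 \<Longrightarrow> F (u *\<^sub>R x + v *\<^sub>R x') (u *\<^sub>R y + v *\<^sub>R y') \<le> ennreal u * F x y + ennreal v * F x' y'"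
  shows "ennreal_convex_on S (\<lambda>x. INF y\<in>K. F x y)"
  unfolding ennreal_convex_on_def
proof (intro ballI allI impI)
  fix x x' and u v :: real assume x: "x \<in> S" "x' \<in> S" and uv: "0 \<le> u" "0 \<le> v" "u + v = 1"
  let ?g = "\<lambda>x. INF y\<in>K. F x y"
  show "?g (u *\<^sub>R x + v *\<^sub>R x') \<le> ennreal u * ?g x + ennreal v * ?g x'"
  proof (cases "u = 0 \<or> v = 0")
    case True
    then show ?thesis
      using uv by auto
  next
    case False
    then have uv': "0 < u" "0 < v"
      using uv by auto
    show ?thesis
    proof (rule ennreal_le_epsilon)
      fix e :: real
      assume fin: "ennreal u * ?g x + ennreal v * ?g x' < top" and e: "0 < e"
      have "?g x < top" "?g x' < top"
        using fin uv' by (auto simp: ennreal_mult_less_top)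
      moreover have "a < a + ennreal e" if "a < top" for a
        using that e
        by (cases a) (auto simp: ennreal_less_iff ennreal_plus[symmetric] simp del: ennreal_plus)
      ultimately have "?g x < ?g x + ennreal e" "?g x' < ?g x' + ennreal e"
        by blast+
      then obtain y y' where y: "y \<in> K" "F x y < ?g x + ennreal e"
        and y': "y' \<in> K" "F x' y' < ?g x' + ennreal e"
        unfolding INF_less_iff by blast
      have "?g (u *\<^sub>R x + v *\<^sub>R x') \<le> F (u *\<^sub>R x + v *\<^sub>R x') (u *\<^sub>R y + v *\<^sub>R y')"
        using convexD[OF K y(1) y'(1) uv] by (rule INF_lower)
      also have "\<dots> \<le> ennreal u * F x y + ennreal v * F x' y'"
        using x y(1) y'(1) uv by (rule F)
      also have "\<dots> \<le> ennreal u * (?g x + ennreal e) + ennreal v * (?g x' + ennreal e)"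
        using y(2) y'(2) by (intro add_mono mult_left_mono) auto
      also have "\<dots> = ennreal u * ?g x + ennreal v * ?g x' + (ennreal u + ennreal v) * ennreal e"
        by (simp add: distrib_left distrib_right add_ac)
      also have "ennreal u + ennreal v = 1"
        using uv by (simp add: ennreal_plus[symmetric] del: ennreal_plus)
      finally show "?g (u *\<^sub>R x + v *\<^sub>R x') \<le> ennreal u * ?g x + ennreal v * ?g x' + ennreal e"
        by simp
    qed
  qed
qed

lemma ext_convex_enn2erealD:
  assumes "ext_convex (\<lambda>(x, y). enn2ereal (f x y))" "0 \<le> u" "0 \<le> v" "u + v = 1"
  shows "f (u *\<^sub>R x + v *\<^sub>R x') (u *\<^sub>R y + v *\<^sub>R y') \<le> ennreal u * f x y + ennreal v * f x' y'"
proof -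
  have "enn2ereal (f (u *\<^sub>R x + v *\<^sub>R x') (u *\<^sub>R y + v *\<^sub>R y'))
      \<le> ereal u * enn2ereal (f x y) + ereal v * enn2ereal (f x' y')"
    using assms(1)[unfolded ext_convex_def, rule_format, OF assms(2-4), of "(x, y)" "(x', y')"]
    by simp
  then show ?thesis
    using assms(2,3)
    by (simp add: less_eq_ennreal.rep_eq plus_ennreal.rep_eq times_ennreal.rep_eq enn2ereal_ennreal)
qed

locale multistage =
  fixes P :: "('b::euclidean_space, 'a::euclidean_space, 'm::euclidean_space) problem"
  assumes valid: "valid_problem P" and regular: "regularity P"
begin

abbreviation "T \<equiv> horizon P"
abbreviation "X \<equiv> state_set P"
abbreviation "N \<equiv> nrm P"
abbreviation "Q \<equiv> cost_to_go P"
abbreviation "L t \<equiv> lip P (Suc t)"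

lemma T_ge_2: "2 \<le> T"
  using valid by (simp add: valid_problem_def)

lemma
  assumes "1 \<le> t" "t \<le> T"
  shows X_nonempty: "X t \<noteq> {}" and X_compact: "compact (X t)" and X_convex: "convex (X t)"
    and norm_N: "is_norm (N t)" and interior_X: "interior (X t) \<noteq> {}"
proof -
  show X: "X t \<noteq> {}" "compact (X t)" "convex (X t)" "is_norm (N t)"
    using valid assms by (auto simp: valid_problem_def)
  have "affine hull (X t) = UNIV"
    using regular assms by (subst aff_dim_eq_full[symmetric]) (auto simp: regularity_def)
  then have "rel_interior (X t) = interior (X t)"
    by (rule rel_interior_interior)
  then show "interior (X t) \<noteq> {}"
    using X by (simp add: rel_interior_eq_empty[symmetric])
qed

lemma
  assumes "1 \<le> t" "t < T"
  shows cost_lsc: "lsc_on (UNIV \<times> UNIV \<times> unc_set P (Suc t)) (\<lambda>(x, y, xi). cost P (Suc t) x y xi)"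
    and cost_convex: "xi \<in> unc_set P (Suc t) \<Longrightarrow>
        ext_convex (\<lambda>(x, y). enn2ereal (cost P (Suc t) x y xi))"
    and ambiguity_nonempty: "ambiguity P (Suc t) \<noteq> {}"
    and ambiguity_prob: "p \<in> ambiguity P (Suc t) \<Longrightarrow> prob_space p"
    and ambiguity_sets: "p \<in> ambiguity P (Suc t) \<Longrightarrow>
        sets p = sets (restrict_space borel (unc_set P (Suc t)))"
    and L_pos: "0 < L t"
    and stage_value_finite: "xi \<in> unc_set P (Suc t) \<Longrightarrow> x \<in> X t \<Longrightarrow>
        stage_value P (Suc t) (Q (Suc t)) x xi < \<infinity>"
proof -
  have t: "Suc t \<in> {2..T}"
    using assms by auto
  from valid t show "lsc_on (UNIV \<times> UNIV \<times> unc_set P (Suc t)) (\<lambda>(x, y, xi). cost P (Suc t) x y xi)"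
    "xi \<in> unc_set P (Suc t) \<Longrightarrow> ext_convex (\<lambda>(x, y). enn2ereal (cost P (Suc t) x y xi))"
    "ambiguity P (Suc t) \<noteq> {}" "p \<in> ambiguity P (Suc t) \<Longrightarrow> prob_space p"
    "p \<in> ambiguity P (Suc t) \<Longrightarrow> sets p = sets (restrict_space borel (unc_set P (Suc t)))"
    unfolding valid_problem_def by blast+
  from regular t show "0 < L t" "xi \<in> unc_set P (Suc t) \<Longrightarrow> x \<in> X t \<Longrightarrow>
      stage_value P (Suc t) (Q (Suc t)) x xi < \<infinity>"
    unfolding regularity_def by fastforce+
qed

lemma ambiguity_space:
  assumes "1 \<le> t" "t < T" "p \<in> ambiguity P (Suc t)"
  shows "space p = unc_set P (Suc t)"
  using sets_eq_imp_space_eq[OF ambiguity_sets[OF assms]] by (simp add: space_restrict_space)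

lemma stage_value_lipschitz:
  assumes t: "1 \<le> t" "t < T" and xi: "xi \<in> unc_set P (Suc t)"
  shows "ennreal_lipschitz_on (X t) (N t) (L t) (\<lambda>x. stage_value P (Suc t) (Q (Suc t)) x xi)"
  unfolding ennreal_lipschitz_on_def
proof (intro ballI)
  fix x y assume xy: "x \<in> X t" "y \<in> X t"
  let ?g = "\<lambda>x. stage_value P (Suc t) (Q (Suc t)) x xi"
  have "Suc t \<in> {2..T}"
    using t by auto
  with regular xi xy have "\<bar>enn2real (?g x) - enn2real (?g y)\<bar> \<le> L t * N t (x - y)"
    unfolding regularity_def by (metis diff_Suc_1)
  then have "enn2real (?g x) \<le> enn2real (?g y) + L t * N t (x - y)"
    by linarith
  then have "ennreal (enn2real (?g x)) \<le> ennreal (enn2real (?g y) + L t * N t (x - y))"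
    by (rule ennreal_leI)
  then show "?g x \<le> ?g y + ennreal (L t * N t (x - y))"
    using stage_value_finite[OF t xi] xy L_pos[OF t] is_norm_nonneg[OF norm_N, of t] t by simp
qed

lemma Q_last [simp]: "Q T x = 0"
  by (simp add: cost_to_go.simps)

lemma Q_step: "t < T \<Longrightarrow> Q t x = worst_case P (Suc t) (stage_value P (Suc t) (Q (Suc t)) x)"
  by (subst cost_to_go.simps) simp

lemma stage_value_convex:
  assumes t: "1 \<le> t" "t < T" and xi: "xi \<in> unc_set P (Suc t)" and V: "ennreal_convex_on UNIV V"
  shows "ennreal_convex_on UNIV (\<lambda>x. stage_value P (Suc t) V x xi)"
  unfolding stage_value_def
proof (rule ennreal_convex_on_INF)
  show "convex (X (Suc t))"
    using t by (intro X_convex) auto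
  fix x x' y y' :: 'a and u v :: real assume uv: "0 \<le> u" "0 \<le> v" "u + v = 1"
  have "cost P (Suc t) (u *\<^sub>R x + v *\<^sub>R x') (u *\<^sub>R y + v *\<^sub>R y') xi + V (u *\<^sub>R y + v *\<^sub>R y')
      \<le> (ennreal u * cost P (Suc t) x y xi + ennreal v * cost P (Suc t) x' y' xi)
        + (ennreal u * V y + ennreal v * V y')"
    using V uv ext_convex_enn2erealD[OF cost_convex[OF t xi] uv]
    by (intro add_mono) (auto simp: ennreal_convex_on_def)
  then show "cost P (Suc t) (u *\<^sub>R x + v *\<^sub>R x') (u *\<^sub>R y + v *\<^sub>R y') xi + V (u *\<^sub>R y + v *\<^sub>R y')
      \<le> ennreal u * (cost P (Suc t) x y xi + V y) + ennreal v * (cost P (Suc t) x' y' xi + V y')"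
    by (simp add: distrib_left add_ac)
qed

text \<open>Minimizing over the compact state space keeps the lower semicontinuity of the cost in the
  uncertain parameter. Measurability makes the integrals additive, on which convexity and
  Lipschitz continuity of the expectations rest.\<close>

lemma stage_value_measurable:
  assumes t: "1 \<le> t" "t < T" and V: "lsc_on (X (Suc t)) V" and p: "p \<in> ambiguity P (Suc t)"
  shows "stage_value P (Suc t) V x \<in> borel_measurable p"
proof -
  let ?S = "unc_set P (Suc t)"
  have "lsc_on (X (Suc t) \<times> ?S) (\<lambda>w. case (x, w) of (x, y, xi) \<Rightarrow> cost P (Suc t) x y xi)"
    by (rule lsc_on_compose[OF cost_lsc[OF t]]) (auto intro!: continuous_intros)
  moreover have "lsc_on (X (Suc t) \<times> ?S) (\<lambda>w. V (fst w))"
    by (rule lsc_on_compose[OF V]) (auto intro!: continuous_intros)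
  ultimately have "lsc_on (X (Suc t) \<times> ?S) (\<lambda>(y, xi). cost P (Suc t) x y xi + V y)"
    using lsc_on_add_ennreal by (fastforce simp: case_prod_beta')
  then have "lsc_on ?S (\<lambda>xi. INF y\<in>X (Suc t). cost P (Suc t) x y xi + V y)"
    using t by (intro lsc_on_INF_compact X_compact) auto
  then have "stage_value P (Suc t) V x \<in> borel_measurable (restrict_space borel ?S)"
    unfolding stage_value_def by (rule borel_measurable_lsc_on)
  then show ?thesis
    using measurable_cong_sets[OF ambiguity_sets[OF t p] refl] by blast
qed

lemma worst_case_lipschitz:
  assumes t: "1 \<le> t" "t < T"
    and meas: "\<And>x p. p \<in> ambiguity P (Suc t) \<Longrightarrow> g x \<in> borel_measurable p"
    and lip: "\<And>xi. xi \<in> unc_set P (Suc t) \<Longrightarrow> ennreal_lipschitz_on S M K (\<lambda>x. g x xi)"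
  shows "ennreal_lipschitz_on S M K (\<lambda>x. worst_case P (Suc t) (g x))"
  unfolding ennreal_lipschitz_on_def
proof (intro ballI)
  fix x y assume xy: "x \<in> S" "y \<in> S"
  let ?c = "ennreal (K * M (x - y))"
  show "worst_case P (Suc t) (g x) \<le> worst_case P (Suc t) (g y) + ?c"
    unfolding worst_case_def
  proof (rule SUP_least)
    fix p assume p: "p \<in> ambiguity P (Suc t)"
    interpret prob_space p
      using ambiguity_prob[OF t p] .
    have "(\<integral>\<^sup>+ xi. g x xi \<partial>p) \<le> (\<integral>\<^sup>+ xi. g y xi + ?c \<partial>p)"
      using lip xy by (intro nn_integral_mono) (simp add: ambiguity_space[OF t p] ennreal_lipschitz_on_def)
    also have "\<dots> = (\<integral>\<^sup>+ xi. g y xi \<partial>p) + ?c"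
      using meas[OF p] by (subst nn_integral_add) (auto simp: emeasure_space_1)
    also have "\<dots> \<le> (SUP p\<in>ambiguity P (Suc t). \<integral>\<^sup>+ xi. g y xi \<partial>p) + ?c"
      using p by (intro add_right_mono SUP_upper)
    finally show "(\<integral>\<^sup>+ xi. g x xi \<partial>p) \<le> (SUP p\<in>ambiguity P (Suc t). \<integral>\<^sup>+ xi. g y xi \<partial>p) + ?c" .
  qed
qed

lemma worst_case_convex:
  assumes t: "1 \<le> t" "t < T"
    and meas: "\<And>x p. p \<in> ambiguity P (Suc t) \<Longrightarrow> g x \<in> borel_measurable p"
    and conv: "\<And>xi. xi \<in> unc_set P (Suc t) \<Longrightarrow> ennreal_convex_on S (\<lambda>x. g x xi)"
  shows "ennreal_convex_on S (\<lambda>x. worst_case P (Suc t) (g x))"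
  unfolding ennreal_convex_on_def
proof (intro ballI allI impI)
  fix x y and u v :: real assume xy: "x \<in> S" "y \<in> S" and uv: "0 \<le> u" "0 \<le> v" "u + v = 1"
  let ?W = "worst_case P (Suc t)"
  show "?W (g (u *\<^sub>R x + v *\<^sub>R y)) \<le> ennreal u * ?W (g x) + ennreal v * ?W (g y)"
    unfolding worst_case_def
  proof (rule SUP_least)
    fix p assume p: "p \<in> ambiguity P (Suc t)"
    have "(\<integral>\<^sup>+ xi. g (u *\<^sub>R x + v *\<^sub>R y) xi \<partial>p) \<le> (\<integral>\<^sup>+ xi. ennreal u * g x xi + ennreal v * g y xi \<partial>p)"
      using conv xy uv
      by (intro nn_integral_mono) (simp add: ambiguity_space[OF t p] ennreal_convex_on_def)
    also have "\<dots> = ennreal u * (\<integral>\<^sup>+ xi. g x xi \<partial>p) + ennreal v * (\<integral>\<^sup>+ xi. g y xi \<partial>p)"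
      using meas[OF p] by (simp add: nn_integral_add nn_integral_cmult)
    also have "\<dots> \<le> ennreal u * (SUP p\<in>ambiguity P (Suc t). \<integral>\<^sup>+ xi. g x xi \<partial>p)
        + ennreal v * (SUP p\<in>ambiguity P (Suc t). \<integral>\<^sup>+ xi. g y xi \<partial>p)"
      using p by (intro add_mono mult_left_mono SUP_upper) auto
    finally show "(\<integral>\<^sup>+ xi. g (u *\<^sub>R x + v *\<^sub>R y) xi \<partial>p)
      \<le> ennreal u * (SUP p\<in>ambiguity P (Suc t). \<integral>\<^sup>+ xi. g x xi \<partial>p)
        + ennreal v * (SUP p\<in>ambiguity P (Suc t). \<integral>\<^sup>+ xi. g y xi \<partial>p)" .
  qed
qed

text \<open>Backward induction: convexity and lower semicontinuity of one cost-to-go function give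
  convexity and measurability of the preceding stage values, which the worst-case expectation turns
  into convexity and Lipschitz continuity of the preceding cost-to-go function.\<close>

lemma Q_convex_lsc:
  assumes "1 \<le> t" "t \<le> T"
  shows "ennreal_convex_on UNIV (Q t) \<and> lsc_on (X t) (Q t) \<and>
    (t < T \<longrightarrow> ennreal_lipschitz_on (X t) (N t) (L t) (Q t))"
  using assms(2)
proof (induction t rule: inc_induct)
  case base
  then show ?case
    by (auto simp: ennreal_convex_on_def lsc_on_def)
next
  case (step n)
  have n: "1 \<le> n" "n < T"
    using step assms by auto
  have meas: "stage_value P (Suc n) (Q (Suc n)) x \<in> borel_measurable p"
    if "p \<in> ambiguity P (Suc n)" for p x
    using stage_value_measurable[OF n _ that] step by blast
  have Q_eq: "Q n = (\<lambda>x. worst_case P (Suc n) (stage_value P (Suc n) (Q (Suc n)) x))"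
    using n by (auto simp: Q_step)
  have lip: "ennreal_lipschitz_on (X n) (N n) (L n) (Q n)"
    unfolding Q_eq using meas stage_value_lipschitz n by (intro worst_case_lipschitz) auto
  moreover have "ennreal_convex_on UNIV (Q n)"
    unfolding Q_eq using meas stage_value_convex n step by (intro worst_case_convex) auto
  moreover have "lsc_on (X n) (Q n)"
    using n L_pos by (intro lsc_on_ennreal_lipschitz[OF norm_N _ lip]) (auto intro: less_imp_le)
  ultimately show ?case
    by blast
qed

lemma Q_convex: "1 \<le> t \<Longrightarrow> t \<le> T \<Longrightarrow> ennreal_convex_on UNIV (Q t)"
  and Q_lipschitz: "1 \<le> t \<Longrightarrow> t < T \<Longrightarrow> ennreal_lipschitz_on (X t) (N t) (L t) (Q t)"
  using Q_convex_lsc by auto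

text \<open>On the state space the regularization changes nothing. The choice \<open>z = x\<close> gives one
  inequality. For the other, the slope of an affine minorant that is \<open>L t\<close>-Lipschitz is an admissible
  multiplier, and such minorants approximate the stage value at every state.\<close>

lemma reg_stage_value_eq:
  assumes t: "1 \<le> t" "t < T" and xi: "xi \<in> unc_set P (Suc t)" and x: "x \<in> X t"
    and V: "\<And>y. y \<in> X (Suc t) \<Longrightarrow> V y = Q (Suc t) y"
  shows "e2ennreal (reg_stage_value P (Suc t) V x xi) = stage_value P (Suc t) (Q (Suc t)) x xi"
proof (rule antisym)
  let ?g = "\<lambda>x. stage_value P (Suc t) (Q (Suc t)) x xi"
  have N: "is_norm (N t)"
    using t by (intro norm_N) auto
  have L: "0 \<le> L t"
    using L_pos[OF t] by simp
  show "e2ennreal (reg_stage_value P (Suc t) V x xi) \<le> ?g x"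
    unfolding stage_value_def
  proof (rule INF_greatest)
    fix y assume y: "y \<in> X (Suc t)"
    have "reg_stage_value P (Suc t) V x xi \<le> enn2ereal (cost P (Suc t) x y xi + V y)"
      unfolding reg_stage_value_def
    proof (rule SUP_least)
      fix l
      show "(INF (y, z)\<in>X (Suc t) \<times> UNIV. enn2ereal (cost P (Suc t) z y xi + V y) + ereal (l \<bullet> (x - z)))
          \<le> enn2ereal (cost P (Suc t) x y xi + V y)"
        using y by (intro INF_lower2[of "(y, x)"]) auto
    qed
    then have "e2ennreal (reg_stage_value P (Suc t) V x xi) \<le> cost P (Suc t) x y xi + V y"
      using e2ennreal_mono by fastforce
    then show "e2ennreal (reg_stage_value P (Suc t) V x xi) \<le> cost P (Suc t) x y xi + Q (Suc t) y"
      using V[OF y] by simp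
  qed
  show "?g x \<le> e2ennreal (reg_stage_value P (Suc t) V x xi)"
  proof (rule ennreal_le_epsilon)
    fix e :: real assume e: "0 < e"
    obtain l b where lb: "\<And>u. l \<bullet> u \<le> L t * N t u" "\<And>z. ereal (l \<bullet> z + b) \<le> enn2ereal (?g z)"
      "enn2real (?g x) - e \<le> l \<bullet> x + b"
      using affine_minorant_approx[OF convex_UNIV stage_value_convex[OF t xi Q_convex] subset_UNIV
          X_convex interior_X x N L stage_value_lipschitz[OF t xi] stage_value_finite[OF t xi x] e] t
      by (auto simp: less_imp_le)
    have "ereal (l \<bullet> x + b) \<le> (INF (y, z)\<in>X (Suc t) \<times> UNIV.
        enn2ereal (cost P (Suc t) z y xi + V y) + ereal (l \<bullet> (x - z)))"
    proof (rule INF_greatest, clarify)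
      fix y z assume y: "y \<in> X (Suc t)"
      have "ereal (l \<bullet> x + b) = ereal (l \<bullet> z + b) + ereal (l \<bullet> (x - z))"
        by (simp add: inner_diff_right)
      also have "?g z \<le> cost P (Suc t) z y xi + V y"
        unfolding stage_value_def using y V by (auto intro: INF_lower2)
      then have "ereal (l \<bullet> z + b) \<le> enn2ereal (cost P (Suc t) z y xi + V y)"
        using lb(2)[of z] by (auto simp: less_eq_ennreal.rep_eq intro: order_trans)
      then have "ereal (l \<bullet> z + b) + ereal (l \<bullet> (x - z))
          \<le> enn2ereal (cost P (Suc t) z y xi + V y) + ereal (l \<bullet> (x - z))"
        by (rule add_right_mono)
      finally show "ereal (l \<bullet> x + b) \<le> enn2ereal (cost P (Suc t) z y xi + V y) + ereal (l \<bullet> (x - z))" .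
    qed
    also have "\<dots> \<le> reg_stage_value P (Suc t) V x xi"
      unfolding reg_stage_value_def using dual_norm_le[OF N L lb(1)] by (intro SUP_upper) simp
    finally have "ereal (enn2real (?g x) - e) \<le> reg_stage_value P (Suc t) V x xi"
      using lb(3) by (meson ereal_less_eq(3) order_trans)
    then have "ennreal (enn2real (?g x) - e) \<le> e2ennreal (reg_stage_value P (Suc t) V x xi)"
      using e2ennreal_mono[of "ereal (enn2real (?g x) - e)"] by (simp add: e2ennreal_ereal)
    then have "ennreal (enn2real (?g x) - e) + ennreal e
        \<le> e2ennreal (reg_stage_value P (Suc t) V x xi) + ennreal e"
      by (rule add_right_mono)
    moreover have "?g x \<le> ennreal (enn2real (?g x) - e) + ennreal e"
    proof -
      have "?g x = ennreal (enn2real (?g x))"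
        using stage_value_finite[OF t xi x] by simp
      also have "\<dots> \<le> ennreal (enn2real (?g x) - e) + ennreal e"
        using e ennreal_plus_if[of "enn2real (?g x) - e" e] by (auto intro!: ennreal_leI simp: max_def)
      finally show ?thesis .
    qed
    ultimately show "?g x \<le> e2ennreal (reg_stage_value P (Suc t) V x xi) + ennreal e"
      by (rule order_trans[rotated])
  qed
qed

lemma reg_cost_to_go_eq:
  assumes "1 \<le> t" "t \<le> T" "x \<in> X t"
  shows "reg_cost_to_go P t x = Q t x"
  using assms(2,3)
proof (induction t arbitrary: x rule: inc_induct)
  case base
  then show ?case
    by (simp add: reg_cost_to_go.simps)
next
  case (step n)
  have n: "1 \<le> n" "n < T"
    using step assms by auto
  have "(\<integral>\<^sup>+ xi. e2ennreal (reg_stage_value P (Suc n) (reg_cost_to_go P (Suc n)) x xi) \<partial>p)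
      = (\<integral>\<^sup>+ xi. stage_value P (Suc n) (Q (Suc n)) x xi \<partial>p)" if "p \<in> ambiguity P (Suc n)" for p
    using step.IH step.prems n
    by (intro nn_integral_cong reg_stage_value_eq) (auto simp: ambiguity_space[OF n that])
  then show ?case
    using n by (subst reg_cost_to_go.simps) (simp add: Q_step worst_case_def)
qed

lemma Q_ge:
  assumes cost_ge: "\<And>t x y xi. 1 \<le> t \<Longrightarrow> t < T \<Longrightarrow> x \<in> X t \<Longrightarrow> y \<in> X (Suc t) \<Longrightarrow>
      xi \<in> unc_set P (Suc t) \<Longrightarrow> ennreal C \<le> cost P (Suc t) x y xi"
    and C: "0 \<le> C" and t: "1 \<le> t" "t \<le> T" and x: "x \<in> X t"
  shows "ennreal (real (T - t) * C) \<le> Q t x"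
  using t(2) x
proof (induction t arbitrary: x rule: inc_induct)
  case base
  then show ?case
    by simp
next
  case (step n)
  have n: "1 \<le> n" "n < T"
    using step t by auto
  let ?c = "ennreal (real (T - n) * C)"
  have "real (T - n) * C = C + real (T - Suc n) * C"
    using n by (simp add: algebra_simps of_nat_diff)
  then have c: "?c = ennreal C + ennreal (real (T - Suc n) * C)"
    using C by (simp add: ennreal_plus[symmetric] del: ennreal_plus)
  obtain p where p: "p \<in> ambiguity P (Suc n)"
    using ambiguity_nonempty[OF n] by blast
  interpret prob_space p
    using ambiguity_prob[OF n p] .
  have "?c = (\<integral>\<^sup>+ xi. ?c \<partial>p)"
    by (simp add: emeasure_space_1)
  also have "\<dots> \<le> (\<integral>\<^sup>+ xi. stage_value P (Suc n) (Q (Suc n)) x xi \<partial>p)"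
  proof (rule nn_integral_mono)
    fix xi assume "xi \<in> space p"
    then have xi: "xi \<in> unc_set P (Suc n)"
      using ambiguity_space[OF n p] by simp
    show "?c \<le> stage_value P (Suc n) (Q (Suc n)) x xi"
      unfolding stage_value_def c using step.IH step.prems n xi
      by (intro INF_greatest add_mono cost_ge) auto
  qed
  also have "\<dots> \<le> Q n x"
    unfolding Q_step[OF n(2)] worst_case_def using p by (rule SUP_upper)
  finally show ?case .
qed

end


section \<open>Approximations of the cost-to-go functions\<close>

context multistage
begin

definition affine_minorant :: "nat \<Rightarrow> 'a \<Rightarrow> real \<Rightarrow> bool" where
  "affine_minorant t l b \<longleftrightarrow>
     (\<forall>u. l \<bullet> u \<le> L t * N t u) \<and> (\<forall>z\<in>X t. ereal (l \<bullet> z + b) \<le> enn2ereal (Q t z))"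

text \<open>The infimum in \<open>conv2\<close> ranges over the whole space, whereas the cost-to-go function is Lipschitz
  on the state space only; so domination of \<open>Q t\<close> on \<open>X t\<close> alone is not preserved by refinement.
  Domination of all \<open>L t\<close>-Lipschitz affine minorants, everywhere, is preserved, and on \<open>X t\<close> it
  implies domination of \<open>Q t\<close>.\<close>

definition sound_approx :: "nat \<Rightarrow> ('a \<Rightarrow> real) \<Rightarrow> ('a \<Rightarrow> ereal) \<Rightarrow> bool" where
  "sound_approx t lo hi \<longleftrightarrow>
     continuous_on UNIV lo \<and> convex_on UNIV lo \<and> (\<forall>x\<in>X t. ereal (lo x) \<le> enn2ereal (Q t x)) \<and>
     lsc_on UNIV hi \<and> ext_convex hi \<and> (\<forall>x. 0 \<le> hi x) \<and>
     (\<forall>l b. affine_minorant t l b \<longrightarrow> (\<forall>z. ereal (l \<bullet> z + b) \<le> hi z))"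

lemma sound_approx_upper:
  assumes t: "1 \<le> t" "t < T" and hi: "sound_approx t lo hi" and x: "x \<in> X t"
  shows "enn2ereal (Q t x) \<le> hi x"
proof (cases "Q t x < \<infinity>")
  case True
  have N: "is_norm (N t)"
    using t by (intro norm_N) auto
  have approx: "ereal (enn2real (Q t x) - e) \<le> hi x" if e: "e > 0" for e
  proof -
    have conv: "ennreal_convex_on (X t) (Q t)"
      using Q_convex[of t] t by (auto simp: ennreal_convex_on_def)
    have L: "0 \<le> L t" and X: "convex (X t)" "interior (X t) \<noteq> {}"
      using L_pos[OF t] X_convex[of t] interior_X[of t] t by auto
    obtain l b where lb: "\<And>u. l \<bullet> u \<le> L t * N t u"
      "\<And>z. z \<in> X t \<Longrightarrow> ereal (l \<bullet> z + b) \<le> enn2ereal (Q t z)" "enn2real (Q t x) - e \<le> l \<bullet> x + b"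
      by (rule affine_minorant_approx[OF X(1) conv subset_refl X x N L Q_lipschitz[OF t] True e])
        (rule that)
    then have "affine_minorant t l b"
      by (simp add: affine_minorant_def)
    with lb(3) show ?thesis
      using hi unfolding sound_approx_def by (meson ereal_less_eq(3) order_trans)
  qed
  have "ereal (enn2real (Q t x)) \<le> hi x"
  proof (cases "hi x")
    case (real r)
    then have "enn2real (Q t x) \<le> r + e" if "e > 0" for e
      using approx[OF that] by simp
    then show ?thesis
      unfolding real by (simp add: field_le_epsilon)
  qed (use approx[of 1] in auto)
  then show ?thesis
    using True by (cases "Q t x") auto
next
  case False
  \<comment> \<open>Then the cost-to-go function is infinite everywhere, and every constant is a minorant.\<close>
  have "Q t z = \<infinity>" if "z \<in> X t" for z
    using ennreal_lipschitz_on_finite[OF Q_lipschitz[OF t] that x] False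
    by (auto simp: less_top[symmetric])
  then have "affine_minorant t 0 b" for b
    using L_pos[OF t] is_norm_nonneg[OF norm_N, of t] t by (auto simp: affine_minorant_def)
  then have "ereal b \<le> hi x" for b
    using hi unfolding sound_approx_def by (metis add_0 inner_zero_left)
  then have "hi x = \<infinity>"
    using ereal_top by blast
  then show ?thesis
    by simp
qed

definition sound_approxs :: "(nat \<Rightarrow> 'a \<Rightarrow> real) \<Rightarrow> (nat \<Rightarrow> 'a \<Rightarrow> ereal) \<Rightarrow> bool" where
  "sound_approxs lo hi \<longleftrightarrow>
     (\<forall>t\<in>{1..<T}. sound_approx t (lo t) (hi t)) \<and> lo T = (\<lambda>x. 0) \<and> hi T = (\<lambda>x. 0)"

lemma valid_approx_sound:
  assumes sound: "sound_approxs lo hi" and t: "1 \<le> t" "t \<le> T"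
  shows "valid_approx P t (lo t) (hi t)"
proof (cases "t = T")
  case True
  then show ?thesis
    using sound reg_cost_to_go_eq[OF t]
    by (auto simp: valid_approx_def sound_approxs_def lsc_on_def ext_convex_def convex_on_def
        zero_ennreal.rep_eq zero_ereal_def[symmetric])
next
  case False
  then have t': "1 \<le> t" "t < T"
    using t by auto
  have s: "sound_approx t (lo t) (hi t)"
    using sound t' by (auto simp: sound_approxs_def)
  have "lsc_on UNIV (lo t)"
    using s unfolding sound_approx_def lsc_on_def continuous_on_def
    by (auto intro: order_tendstoD(1))
  moreover have "hi t x \<noteq> - \<infinity>" for x
    using s unfolding sound_approx_def by (metis not_MInfty_nonneg)
  ultimately show ?thesis
    using s sound_approx_upper[OF t' s] reg_cost_to_go_eq[OF t]
    unfolding valid_approx_def sound_approx_def by auto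
qed

lemma sound_approxs_init: "sound_approxs init_low (init_upp P)"
  using T_ge_2
  by (auto simp: sound_approxs_def sound_approx_def init_low_def[abs_def] init_upp_def[abs_def]
      lsc_on_def ext_convex_def convex_on_def
        zero_ennreal.rep_eq zero_ereal_def[symmetric])

text \<open>The guarantees of an oracle answer for the state \<open>x\<close> of stage \<open>t\<close>, with the regularized
  cost-to-go function replaced by \<open>Q t\<close>, with which it agrees on \<open>X t\<close>.\<close>

definition sound_answer :: "nat \<Rightarrow> 'a \<Rightarrow> 'a stage_output \<Rightarrow> bool" where
  "sound_answer t x r \<longleftrightarrow>
     (\<exists>a b. out_cut r = (\<lambda>z. a \<bullet> z + b)) \<and>
     (\<forall>z z'. \<bar>out_cut r z - out_cut r z'\<bar> \<le> L t * N t (z - z')) \<and>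
     (\<forall>z\<in>X t. ereal (out_cut r z) \<le> enn2ereal (Q t z)) \<and>
     enn2ereal (Q t x) \<le> out_val r \<and> out_val r - ereal (out_cut r x) \<le> out_gap r"

text \<open>The new cone has slope \<open>L t\<close> and its apex \<open>(x, out_val r)\<close> is above the graph of \<open>Q t\<close>, so it
  stays above every affine minorant of slope at most \<open>L t\<close>.\<close>

lemma sound_approx_refine:
  assumes t: "1 \<le> t" "t < T" and x: "x \<in> X t"
    and s: "sound_approx t lo hi" and r: "sound_answer t x r"
  shows "sound_approx t (refine_low lo r) (refine_upp P (Suc t) hi r x)"
proof -
  let ?h = "\<lambda>y. out_val r + ereal (L t * N t (y - x))"
  obtain a b where ab: "out_cut r = (\<lambda>z. a \<bullet> z + b)"
    using r by (auto simp: sound_answer_def)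
  have upp: "refine_upp P (Suc t) hi r x = conv2 hi ?h"
    by (simp add: refine_upp_def)
  have nonneg: "0 \<le> out_val r"
    using r by (auto simp: sound_answer_def intro: order_trans[OF enn2ereal_nonneg])
  have LN: "0 \<le> L t * N t u" for u
    using L_pos[OF t] is_norm_nonneg[OF norm_N, of t] t by auto
  have h: "0 \<le> ?h y" for y
    using nonneg LN by simp
  have hi: "0 \<le> hi y" for y
    using s by (simp add: sound_approx_def)
  have cut: "convex_on UNIV (out_cut r)" "continuous_on UNIV (out_cut r)"
  proof -
    show "convex_on UNIV (out_cut r)"
      unfolding convex_on_def ab
    proof (intro conjI ballI allI impI convex_UNIV)
      fix y z :: 'a and u v :: real assume "u + v = 1"
      then have "b = u * b + v * b"
        by (metis distrib_right mult_1)
      then show "a \<bullet> (u *\<^sub>R y + v *\<^sub>R z) + b \<le> u * (a \<bullet> y + b) + v * (a \<bullet> z + b)"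
        by (simp add: inner_add_right algebra_simps)
    qed
    show "continuous_on UNIV (out_cut r)"
      unfolding ab by (intro continuous_intros)
  qed
  have "ereal (l \<bullet> z + c) \<le> refine_upp P (Suc t) hi r x z" if l: "affine_minorant t l c" for l c z
    unfolding upp
  proof (rule affine_le_conv2)
    show "ereal (l \<bullet> z + c) \<le> hi z" for z
      using s l by (auto simp: sound_approx_def)
    show "ereal (l \<bullet> z + c) \<le> ?h z" for z
    proof -
      have "l \<bullet> (z - x) \<le> L t * N t (z - x)"
        using l by (simp add: affine_minorant_def)
      then have "ereal (l \<bullet> z + c) \<le> ereal (l \<bullet> x + c) + ereal (L t * N t (z - x))"
        by (simp add: inner_diff_right)
      also have "\<dots> \<le> ?h z"
        using l x r unfolding affine_minorant_def sound_answer_def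
        by (intro add_right_mono) (meson order_trans)
      finally show ?thesis .
    qed
  qed
  then show ?thesis
    using s r cut conv2_nonneg[OF hi h] ext_convex_conv2[OF hi h] lsc_on_conv2[of hi ?h]
    unfolding sound_approx_def upp refine_low_def sound_answer_def
    by (auto intro!: convex_on_max continuous_on_max split: split_max)
qed


section \<open>Saturated states\<close>

text \<open>Around a state \<open>x\<close> at which the gap was closed up to \<open>c\<close>, Lipschitz continuity bounds the gap
  everywhere by a cone. The factor 2 arises because the upper approximation may rise and the
  lower one may fall with slope \<open>L t\<close> each.\<close>

definition gap_cone :: "nat \<Rightarrow> real \<Rightarrow> ('a \<Rightarrow> real) \<Rightarrow> ('a \<Rightarrow> ereal) \<Rightarrow> 'a \<Rightarrow> bool" where
  "gap_cone t c lo hi x \<longleftrightarrow> (\<forall>y. hi y \<le> ereal (lo y + c + 2 * (L t * N t (y - x))))"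

lemma gap_cone_mono:
  assumes "gap_cone t c lo hi x" "\<And>y. lo y \<le> lo' y" "\<And>y. hi' y \<le> hi y"
  shows "gap_cone t c lo' hi' x"
  unfolding gap_cone_def
proof
  fix y
  have "hi' y \<le> ereal (lo y + c + 2 * (L t * N t (y - x)))"
    using assms(1,3) unfolding gap_cone_def by (meson order_trans)
  also have "\<dots> \<le> ereal (lo' y + c + 2 * (L t * N t (y - x)))"
    using assms(2)[of y] by simp
  finally show "hi' y \<le> ereal (lo' y + c + 2 * (L t * N t (y - x)))" .
qed

lemma refine_le:
  "lo y \<le> refine_low lo r y" "refine_upp P t hi r x y \<le> hi y"
  by (auto simp: refine_low_def refine_upp_def conv2_le)

lemma gap_cone_refine:
  assumes r: "sound_answer t x r" and gap: "out_gap r \<le> ereal c"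
  shows "gap_cone t c (refine_low lo r) (refine_upp P (Suc t) hi r x) x"
  unfolding gap_cone_def
proof
  fix y
  let ?n = "L t * N t (y - x)"
  have "out_val r - ereal (out_cut r x) \<le> ereal c"
    using r gap unfolding sound_answer_def by (meson order_trans)
  then have val: "out_val r \<le> ereal (out_cut r x + c)"
    by (cases "out_val r") auto
  have "refine_upp P (Suc t) hi r x y \<le> out_val r + ereal ?n"
    unfolding refine_upp_def using conv2_le(2) by (metis diff_Suc_1)
  also have "\<dots> \<le> ereal (out_cut r x + c) + ereal ?n"
    using val by (rule add_right_mono)
  also have "\<dots> \<le> ereal (out_cut r y + c + 2 * ?n)"
  proof -
    have "\<bar>out_cut r y - out_cut r x\<bar> \<le> ?n"
      using r by (auto simp: sound_answer_def)
    then show ?thesis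
      by simp
  qed
  also have "\<dots> \<le> ereal (refine_low lo r y + c + 2 * ?n)"
    by (simp add: refine_low_def)
  finally show "refine_upp P (Suc t) hi r x y \<le> ereal (refine_low lo r y + c + 2 * ?n)" .
qed

end

text \<open>The tolerated gaps \<open>\<delta> t\<close> decrease by \<open>\<eta>\<close> from stage to stage, down to 0 at the last one. NDDP
  takes all of them as input, and CDDP takes \<open>\<delta> 1\<close> as its accuracy.\<close>

locale multistage_run = multistage P
  for P :: "('b::euclidean_space, 'a::euclidean_space, 'm::euclidean_space) problem" +
  fixes O1 :: "'a init_oracle" and Or :: "nat \<Rightarrow> 'a stage_oracle" and \<eta> M D :: real
  assumes oracles: "valid_oracles P O1 Or" and \<eta>: "\<eta> > 0"
    and L_le: "\<And>t. 1 \<le> t \<Longrightarrow> t < horizon P \<Longrightarrow> lip P (Suc t) \<le> M"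
    and X_bounded: "\<And>t. 1 \<le> t \<Longrightarrow> t < horizon P \<Longrightarrow>
      \<exists>c. state_set P t \<subseteq> norm_cball (nrm P t) c (D / 2)"
begin

definition \<delta> :: "nat \<Rightarrow> real" where "\<delta> t = real (T - t) * \<eta>"

lemma \<delta>_Suc: "t < T \<Longrightarrow> \<delta> t = \<delta> (Suc t) + \<eta>"
  by (simp add: \<delta>_def of_nat_diff algebra_simps)

lemma \<delta>_last: "\<delta> T = 0"
  by (simp add: \<delta>_def)

definition packing_bound :: real where "packing_bound = (1 + 2 * M * D / \<eta>) ^ DIM('a)"

text \<open>A set of states at which the gap has been closed to \<open>\<delta> (Suc t)\<close>. Their mutual distance is
  the radius at which a cone of slope \<open>2 * M\<close> climbs by \<open>\<eta>\<close>, from \<open>\<delta> (Suc t)\<close> to \<open>\<delta> t\<close>.\<close>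

definition saturated :: "nat \<Rightarrow> 'a set \<Rightarrow> ('a \<Rightarrow> real) \<Rightarrow> ('a \<Rightarrow> ereal) \<Rightarrow> bool" where
  "saturated t A lo hi \<longleftrightarrow>
     finite A \<and> A \<subseteq> X t \<and> (\<forall>x\<in>A. gap_cone t (\<delta> (Suc t)) lo hi x) \<and>
     (\<forall>x\<in>A. \<forall>y\<in>A. x \<noteq> y \<longrightarrow> \<eta> / (2 * M) \<le> N t (x - y))"

lemma M_pos: "0 < M"
  using L_pos[of 1] L_le[of 1] T_ge_2 by simp

lemma card_saturated:
  assumes t: "1 \<le> t" "t < T" and A: "saturated t A lo hi"
  shows "real (card A) \<le> packing_bound"
proof -
  have N: "is_norm (N t)"
    using t by (intro norm_N) auto
  obtain c where c: "X t \<subseteq> norm_cball (N t) c (D / 2)"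
    using X_bounded[OF t] by blast
  obtain x where "x \<in> X t"
    using X_nonempty[of t] t by auto
  then have "0 \<le> D"
    using c is_norm_nonneg[OF N, of "x - c"] by (auto simp: norm_cball_def)
  then have "real (card A) \<le> (1 + D / (\<eta> / (2 * M))) ^ DIM('a)"
    using A c \<eta> M_pos by (intro card_separated_le[OF N]) (auto simp: saturated_def)
  then show ?thesis
    by (simp add: packing_bound_def mult_ac)
qed

lemma saturated_empty: "saturated t {} lo hi"
  by (simp add: saturated_def)

lemma saturated_refine:
  assumes "saturated t A lo hi"
  shows "saturated t A (refine_low lo r) (refine_upp P t' hi r x)"
proof -
  have "gap_cone t c (refine_low lo r) (refine_upp P t' hi r x) y" if "gap_cone t c lo hi y" for c y
    by (rule gap_cone_mono[OF that]) (rule refine_le)+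
  then show ?thesis
    using assms by (auto simp: saturated_def)
qed

text \<open>A state with a gap above \<open>\<delta> t\<close> lies outside the region around the saturated states
  where the cones are at most \<open>\<delta> t\<close>, so it is new, and far from all of them.\<close>

lemma saturated_insert:
  assumes t: "1 \<le> t" "t < T" and A: "saturated t A lo hi" and x: "x \<in> X t"
    and open_gap: "ereal (lo x + \<delta> t) < hi x"
    and r: "sound_answer t x r" and closed: "out_gap r \<le> ereal (\<delta> (Suc t))"
  shows "x \<notin> A" and "saturated t (insert x A) (refine_low lo r) (refine_upp P (Suc t) hi r x)"
proof -
  have N: "is_norm (N t)"
    using t by (intro norm_N) auto
  have far: "\<eta> / (2 * M) < N t (x - y)" if y: "y \<in> A" for y
  proof -
    have "hi x \<le> ereal (lo x + \<delta> (Suc t) + 2 * (L t * N t (x - y)))"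
      using A y by (auto simp: saturated_def gap_cone_def)
    with open_gap have "ereal (lo x + \<delta> t) < ereal (lo x + \<delta> (Suc t) + 2 * (L t * N t (x - y)))"
      by (rule less_le_trans)
    then have "\<eta> < 2 * (L t * N t (x - y))"
      using \<delta>_Suc[OF t(2)] by simp
    also have "\<dots> \<le> 2 * (M * N t (x - y))"
      using L_le[OF t] is_norm_nonneg[OF N] by (intro mult_left_mono mult_right_mono) auto
    finally show ?thesis
      using M_pos by (simp add: field_simps)
  qed
  have "0 < \<eta> / (2 * M)"
    using M_pos \<eta> by simp
  then show "x \<notin> A"
    using far[of x] is_norm_zero[OF N] by auto
  have "\<eta> / (2 * M) \<le> N t (y - x)" if "y \<in> A" for y
    using far[OF that] is_norm_commute[OF N, of x y] by simp
  then show "saturated t (insert x A) (refine_low lo r) (refine_upp P (Suc t) hi r x)"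
    using saturated_refine[OF A, of r "Suc t" x] gap_cone_refine[OF r closed] x far
    by (auto simp: saturated_def intro: less_imp_le)
qed

lemma stage_oracle:
  assumes t: "1 \<le> t" "t < T" and x: "x \<in> X t" and sound: "sound_approxs lo hi"
    and r: "r = Or (Suc t) x (lo (Suc t)) (hi (Suc t))"
  shows "out_state r \<in> X (Suc t)" "sound_answer t x r"
    "out_gap r = hi (Suc t) (out_state r) - ereal (lo (Suc t) (out_state r))"
proof -
  have "is_stage_oracle P (Suc t) (Or (Suc t))"
    using oracles t by (auto simp: valid_oracles_def)
  moreover have "valid_approx P (Suc t) (lo (Suc t)) (hi (Suc t))"
    using t by (intro valid_approx_sound[OF sound]) auto
  ultimately have answer: "out_state r \<in> X (Suc t)" "\<exists>a b. out_cut r = (\<lambda>z. a \<bullet> z + b)"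
    "\<forall>z z'. \<bar>out_cut r z - out_cut r z'\<bar> \<le> L t * N t (z - z')"
    "\<forall>z\<in>X t. ereal (out_cut r z) \<le> enn2ereal (reg_cost_to_go P t z)"
    "enn2ereal (reg_cost_to_go P t x) \<le> out_val r" "out_val r - ereal (out_cut r x) \<le> out_gap r"
    "out_gap r = hi (Suc t) (out_state r) - ereal (lo (Suc t) (out_state r))"
    using x unfolding r is_stage_oracle_def Let_def diff_Suc_1 by blast+
  then show "out_state r \<in> X (Suc t)" "sound_answer t x r"
    "out_gap r = hi (Suc t) (out_state r) - ereal (lo (Suc t) (out_state r))"
    using x t reg_cost_to_go_eq[of t] by (auto simp: sound_answer_def simp del: plus_ereal.simps)
qed

definition all_saturated ::
  "(nat \<Rightarrow> 'a set) \<Rightarrow> (nat \<Rightarrow> 'a \<Rightarrow> real) \<Rightarrow> (nat \<Rightarrow> 'a \<Rightarrow> ereal) \<Rightarrow> bool" where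
  "all_saturated A lo hi \<longleftrightarrow> (\<forall>t\<in>{1..<T}. saturated t (A t) (lo t) (hi t))"

definition saturated_count :: "(nat \<Rightarrow> 'a set) \<Rightarrow> nat" where
  "saturated_count A = (\<Sum>t\<in>{1..<T}. card (A t))"

lemma saturated_count_insert:
  assumes t: "1 \<le> t" "t < T" and A: "all_saturated A lo hi" and x: "x \<notin> A t"
  shows "saturated_count (A(t := insert x (A t))) = saturated_count A + 1"
proof -
  let ?B = "A(t := insert x (A t))"
  have "finite (A t)"
    using A t by (auto simp: all_saturated_def saturated_def)
  moreover have "(\<Sum>j\<in>{1..<T} - {t}. card (?B j)) = (\<Sum>j\<in>{1..<T} - {t}. card (A j))"
    by (rule sum.cong) auto
  ultimately show ?thesis
    using t x sum.remove[of "{1..<T}" t "\<lambda>j. card (?B j)"] sum.remove[of "{1..<T}" t "\<lambda>j. card (A j)"]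
    by (simp add: saturated_count_def)
qed

lemma saturated_count_le:
  assumes "all_saturated A lo hi"
  shows "real (saturated_count A) \<le> (real T - 1) * packing_bound"
proof -
  have "real (saturated_count A) = (\<Sum>t\<in>{1..<T}. real (card (A t)))"
    by (simp add: saturated_count_def)
  also have "\<dots> \<le> (\<Sum>t\<in>{1..<T}. packing_bound)"
    using assms by (intro sum_mono card_saturated) (auto simp: all_saturated_def)
  finally show ?thesis
    using T_ge_2 by (simp add: of_nat_diff)
qed


section \<open>Bounds and incumbents\<close>

abbreviation "f \<equiv> first_cost P"

definition incumbent :: "('a, 'z) run_scheme \<Rightarrow> bool" where
  "incumbent s \<longleftrightarrow>
     ub s = \<infinity> \<or> (\<exists>x\<in>X 1. best s = Some x \<and> enn2ereal (f x + Q 1 x) \<le> ub s)"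

text \<open>What holds right after an evaluation of the initial oracle, whose answer is the current state
  of stage 1.\<close>

definition initial_bounds :: "('a, 'z) run_scheme \<Rightarrow> bool" where
  "initial_bounds s \<longleftrightarrow>
     incumbent s \<and> cur s 1 \<in> X 1 \<and> f (cur s 1) < \<infinity> \<and>
     lb s = enn2ereal (f (cur s 1)) + ereal (low s 1 (cur s 1)) \<and>
     ub s \<le> enn2ereal (f (cur s 1)) + upp s 1 (cur s 1) \<and>
     (\<forall>y\<in>X 1. lb s \<le> enn2ereal (f y + Q 1 y))"

lemma eval_initial_simps [simp]:
  "low (eval_initial P O1 s) = low s" "upp (eval_initial P O1 s) = upp s"
  "evals (eval_initial P O1 s) = Suc (evals s)"
  by (simp_all add: eval_initial_def Let_def)

lemma initial_bounds_eval_initial: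
  assumes sound: "sound_approxs (low s) (upp s)" and inc: "incumbent s"
  shows "initial_bounds (eval_initial P O1 s)"
proof -
  define x where "x = fst (O1 (low s 1) (upp s 1))"
  let ?s = "eval_initial P O1 s" and ?u = "enn2ereal (f x) + upp s 1 x"
  have s: "sound_approx 1 (low s 1) (upp s 1)"
    using sound T_ge_2 by (auto simp: sound_approxs_def)
  have "valid_approx P 1 (low s 1) (upp s 1)"
    using valid_approx_sound[OF sound] T_ge_2 by simp
  then have x: "x \<in> X 1" and opt: "\<forall>y\<in>X 1. enn2ereal (f x) + ereal (low s 1 x)
      \<le> enn2ereal (f y) + ereal (low s 1 y)"
    using oracles unfolding valid_oracles_def is_init_oracle_def x_def
    by (auto simp: case_prod_beta' Let_def)
  obtain y0 where y0: "y0 \<in> X 1" "f y0 < \<infinity>"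
    using valid by (auto simp: valid_problem_def first_cost_def)
  have "enn2ereal (f y0) + ereal (low s 1 y0) < \<infinity>"
    using y0(2) by (cases "f y0") auto
  then have "enn2ereal (f x) + ereal (low s 1 x) < \<infinity>"
    using opt y0(1) by (meson le_less_trans)
  then have fin: "f x < \<infinity>"
    by (cases "f x") auto
  have upper: "enn2ereal (f x + Q 1 x) \<le> ?u"
    using sound_approx_upper[OF _ _ s x] T_ge_2 by (simp add: plus_ennreal.rep_eq add_left_mono)
  have lower: "enn2ereal (f x) + ereal (low s 1 x) \<le> enn2ereal (f y + Q 1 y)" if y: "y \<in> X 1" for y
  proof -
    have "enn2ereal (f x) + ereal (low s 1 x) \<le> enn2ereal (f y) + ereal (low s 1 y)"
      using opt y by blast
    also have "\<dots> \<le> enn2ereal (f y) + enn2ereal (Q 1 y)"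
      using s y by (intro add_left_mono) (simp add: sound_approx_def)
    finally show ?thesis
      by (simp add: plus_ennreal.rep_eq)
  qed
  have fields: "cur ?s 1 = x" "lb ?s = enn2ereal (f x) + ereal (low s 1 x)"
    "ub ?s = (if ?u < ub s then ?u else ub s)" "best ?s = (if ?u < ub s then Some x else best s)"
    by (simp_all add: eval_initial_def Let_def x_def)
  have "incumbent ?s"
    using inc upper x unfolding incumbent_def fields by auto
  then show ?thesis
    using x fin lower unfolding initial_bounds_def eval_initial_simps fields by auto
qed

lemma gap_open:
  assumes s: "initial_bounds s" and gap: "ereal c < ub s - lb s"
  shows "ereal (low s 1 (cur s 1) + c) < upp s 1 (cur s 1)"
proof -
  let ?x = "cur s 1"
  obtain r where r: "f ?x = ennreal r" "0 \<le> r"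
    using s by (cases "f ?x") (auto simp: initial_bounds_def)
  have "ereal c < (ereal r + upp s 1 ?x) - (ereal r + ereal (low s 1 ?x))"
    using s gap r unfolding initial_bounds_def
    by (auto intro: less_le_trans ereal_minus_mono simp: enn2ereal_ennreal)
  then show ?thesis
    by (cases "upp s 1 ?x") auto
qed

text \<open>The total cost is at least \<open>T * C\<close>, so that the absolute gap \<open>(T - 1) * \<alpha> * C\<close> is a relative
  gap of at most \<open>\<alpha>\<close>.\<close>

lemma initial_bounds_alpha_relative_optimal:
  assumes s: "initial_bounds s" and gap: "ub s - lb s \<le> ereal (\<delta> 1)" and eta: "\<eta> = \<alpha> * C"
    and C: "0 < C" "0 < \<alpha>" and first_ge: "\<And>y. y \<in> X 1 \<Longrightarrow> ennreal C \<le> f y"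
    and cost_ge: "\<And>t x y xi. 1 \<le> t \<Longrightarrow> t < T \<Longrightarrow> x \<in> X t \<Longrightarrow> y \<in> X (Suc t) \<Longrightarrow>
      xi \<in> unc_set P (Suc t) \<Longrightarrow> ennreal C \<le> cost P (Suc t) x y xi"
  shows "\<exists>x. best s = Some x \<and> alpha_relative_optimal P \<alpha> x"
proof -
  define m where "m = (INF y\<in>X 1. f y + Q 1 y)"
  have T: "1 \<le> T"
    using T_ge_2 by simp
  obtain a where a: "lb s = ereal a"
    using s by (cases "f (cur s 1)") (auto simp: initial_bounds_def enn2ereal_ennreal)
  have ub: "ub s \<le> ereal (a + \<delta> 1)"
    using gap unfolding a by (cases "ub s") auto
  then obtain x where x: "x \<in> X 1" "best s = Some x" "enn2ereal (f x + Q 1 x) \<le> ub s"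
    using s by (auto simp: initial_bounds_def incumbent_def)
  have fx: "f x + Q 1 x \<le> ennreal (a + \<delta> 1)"
    using e2ennreal_mono[OF order_trans[OF x(3) ub]] by (simp add: e2ennreal_ereal)
  have "m \<le> f x + Q 1 x"
    unfolding m_def using x(1) by (rule INF_lower)
  then have "m < top"
    using fx by (meson ennreal_less_top le_less_trans)
  then obtain \<mu> where \<mu>: "m = ennreal \<mu>" "0 \<le> \<mu>"
    by (cases m) auto
  have "ennreal a \<le> m"
    unfolding m_def
  proof (rule INF_greatest)
    fix y assume "y \<in> X 1"
    then have "ereal a \<le> enn2ereal (f y + Q 1 y)"
      using s a by (auto simp: initial_bounds_def)
    then show "ennreal a \<le> f y + Q 1 y"
      using e2ennreal_mono by (fastforce simp: e2ennreal_ereal)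
  qed
  then have a_le: "a \<le> \<mu>"
    using \<mu> by (simp add: ennreal_le_iff)
  have "ennreal (real T * C) \<le> m"
    unfolding m_def
  proof (rule INF_greatest)
    fix y assume y: "y \<in> X 1"
    have "real T * C = C + real (T - 1) * C"
      using T by (simp add: of_nat_diff algebra_simps)
    then have "ennreal (real T * C) = ennreal C + ennreal (real (T - 1) * C)"
      using C by (simp add: ennreal_plus[symmetric] del: ennreal_plus)
    also have "\<dots> \<le> f y + Q 1 y"
      using Q_ge[OF cost_ge _ order_refl T y] first_ge[OF y] C by (intro add_mono) auto
    finally show "ennreal (real T * C) \<le> f y + Q 1 y" .
  qed
  then have T_le: "real T * C \<le> \<mu>"
    using \<mu> by (simp add: ennreal_le_iff)
  have "\<delta> 1 = (real T - 1) * (\<alpha> * C)"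
    unfolding \<delta>_def using of_nat_diff[OF T, where 'a = real] by (subst eta) simp
  then have "\<delta> 1 \<le> \<alpha> * (real T * C)"
    using C by (simp add: left_diff_distrib)
  also have "\<dots> \<le> \<alpha> * \<mu>"
    using T_le C by (intro mult_left_mono) auto
  finally have "a + \<delta> 1 \<le> (1 + \<alpha>) * \<mu>"
    using a_le by (simp add: algebra_simps)
  then have "f x + Q 1 x \<le> ennreal ((1 + \<alpha>) * \<mu>)"
    using fx by (meson ennreal_leI order_trans)
  also have "\<dots> = ennreal (1 + \<alpha>) * m"
    using C \<mu> by (simp add: ennreal_mult)
  finally show ?thesis
    using x by (auto simp: alpha_relative_optimal_def m_def)
qed


section \<open>CDDP\<close>

text \<open>Every iteration takes \<open>T\<close> evaluations and saturates at least one new state.\<close>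

definition cddp_inv :: "'a run \<Rightarrow> bool" where
  "cddp_inv s \<longleftrightarrow> sound_approxs (low s) (upp s) \<and> initial_bounds s \<and>
     (\<exists>A. all_saturated A (low s) (upp s) \<and> evals s \<le> 1 + T * saturated_count A)"

lemma cddp_inv_init: "cddp_inv (cddp_init P O1)"
proof -
  have "all_saturated (\<lambda>t. {}) init_low (init_upp P)"
    by (simp add: all_saturated_def saturated_empty)
  then show ?thesis
    unfolding cddp_inv_def cddp_init_def
    by (auto simp: sound_approxs_init incumbent_def intro!: initial_bounds_eval_initial exI[of _ "\<lambda>t. {}"])
qed

lemma trial_state_1: "trial_state Or s 1 = cur s 1"
  by (subst trial_state.simps) simp

lemma trial_state_Suc:
  "1 \<le> t \<Longrightarrow> trial_state Or s (Suc t) =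
    out_state (Or (Suc t) (trial_state Or s t) (low s (Suc t)) (upp s (Suc t)))"
  by (subst trial_state.simps) simp

lemma trial_state_in:
  assumes sound: "sound_approxs (low s) (upp s)" and x1: "cur s 1 \<in> X 1" and t: "1 \<le> t" "t \<le> T"
  shows "trial_state Or s t \<in> X t"
  using t
proof (induction t rule: nat_induct_at_least)
  case base
  then show ?case
    using x1 by (simp only: trial_state_1)
next
  case (Suc n)
  then show ?case
    using stage_oracle(1)[OF _ _ _ sound refl] by (simp add: trial_state_Suc)
qed

text \<open>While the stopping criterion fails, the gap at the trial state is above \<open>\<delta> 1\<close> at stage 1,
  and it is \<open>\<delta> T = 0\<close> at the last stage. So there are consecutive stages \<open>t\<close> and \<open>Suc t\<close> where the
  gap is above \<open>\<delta> t\<close> and at most \<open>\<delta> (Suc t)\<close>, and the iteration saturates the trial state of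
  stage \<open>t\<close>.\<close>

lemma cddp_inv_body:
  assumes inv: "cddp_inv s" and gap: "ereal (\<delta> 1) < ub s - lb s"
  shows "cddp_inv (cddp_body P O1 Or s) \<and> evals (cddp_body P O1 Or s) = evals s + T"
proof -
  define x where "x = trial_state Or s"
  define r where "r t = Or t (x (t - 1)) (low s t) (upp s t)" for t
  define lo where "lo t = (if t \<in> {1..<T} then refine_low (low s t) (r (Suc t)) else low s t)" for t
  define hi where "hi t = (if t \<in> {1..<T} then refine_upp P (Suc t) (upp s t) (r (Suc t)) (x t)
    else upp s t)" for t
  define s' where "s' = s\<lparr>low := lo, upp := hi, cur := x, evals := evals s + (T - 1)\<rparr>"
  have body: "cddp_body P O1 Or s = eval_initial P O1 s'"
    unfolding cddp_body_def Let_def s'_def lo_def hi_def r_def x_def by (simp cong: if_cong)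
  obtain A where sound: "sound_approxs (low s) (upp s)" and bnd: "initial_bounds s"
    and A: "all_saturated A (low s) (upp s)" and ev: "evals s \<le> 1 + T * saturated_count A"
    using inv by (auto simp: cddp_inv_def)
  have x1: "x 1 = cur s 1"
    by (simp only: x_def trial_state_1)
  have x_in: "x t \<in> X t" if "1 \<le> t" "t \<le> T" for t
    unfolding x_def using bnd that by (intro trial_state_in[OF sound]) (auto simp: initial_bounds_def)
  have answer: "sound_answer t (x t) (r (Suc t))"
    "out_gap (r (Suc t)) = upp s (Suc t) (x (Suc t)) - ereal (low s (Suc t) (x (Suc t)))"
    if "1 \<le> t" "t < T" for t
    using stage_oracle(2,3)[OF that x_in[OF that(1) less_imp_le[OF that(2)]] sound, of "r (Suc t)"] that
    by (auto simp: r_def x_def trial_state_Suc)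
  let ?open = "\<lambda>t. ereal (low s t (x t) + \<delta> t) < upp s t (x t)"
  have "?open 1"
    using gap_open[OF bnd gap] by (simp only: x1)
  moreover have "\<not> ?open T"
    using sound by (simp add: sound_approxs_def \<delta>_last)
  ultimately have "\<exists>t. 1 \<le> t \<and> t < T \<and> ?open t \<and> \<not> ?open (Suc t)"
    using dec_induct[of 1 T ?open] T_ge_2 by (metis le_trans one_le_numeral)
  then obtain t where t: "1 \<le> t" "t < T" and op: "?open t" and cl: "\<not> ?open (Suc t)"
    by blast
  have closed: "out_gap (r (Suc t)) \<le> ereal (\<delta> (Suc t))"
    unfolding answer(2)[OF t] using cl by (cases "upp s (Suc t) (x (Suc t))") auto
  have At: "saturated t (A t) (low s t) (upp s t)"
    using A t by (auto simp: all_saturated_def)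
  note new = saturated_insert[OF t At x_in[OF t(1) less_imp_le[OF t(2)]] op answer(1)[OF t] closed]
  define B where "B = A(t := insert (x t) (A t))"
  have B: "all_saturated B lo hi"
    unfolding all_saturated_def
  proof
    fix j assume j: "j \<in> {1..<T}"
    show "saturated j (B j) (lo j) (hi j)"
    proof (cases "j = t")
      case True
      then show ?thesis
        using new(2) t by (simp add: B_def lo_def hi_def)
    next
      case False
      then show ?thesis
        using A j saturated_refine by (auto simp: B_def lo_def hi_def all_saturated_def)
    qed
  qed
  have "saturated_count B = saturated_count A + 1"
    unfolding B_def using saturated_count_insert[OF t A new(1)] .
  then have ev': "evals s + T \<le> 1 + T * saturated_count B"
    using ev by simp
  have sound': "sound_approxs lo hi"
    using sound answer(1) x_in unfolding sound_approxs_def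
    by (auto simp: lo_def hi_def intro!: sound_approx_refine)
  have "incumbent s'"
    using bnd by (simp add: initial_bounds_def incumbent_def s'_def)
  then have "initial_bounds (eval_initial P O1 s')"
    using sound' by (intro initial_bounds_eval_initial) (auto simp: s'_def)
  moreover have "evals (eval_initial P O1 s') = evals s + T"
    using T_ge_2 by (simp add: s'_def)
  ultimately show ?thesis
    unfolding body cddp_inv_def using sound' B ev' by (auto simp: s'_def)
qed

lemma cddp_terminates:
  "\<exists>s. cddp P O1 Or (\<delta> 1) = Some s \<and> initial_bounds s \<and> ub s - lb s \<le> ereal (\<delta> 1) \<and>
     real (evals s) \<le> 1 + real T * (real T - 1) * packing_bound"
proof -
  have evals_real: "real (evals s) \<le> 1 + real T * (real T - 1) * packing_bound" if "cddp_inv s" for s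
  proof -
    obtain A where A: "all_saturated A (low s) (upp s)" "evals s \<le> 1 + T * saturated_count A"
      using \<open>cddp_inv s\<close> by (auto simp: cddp_inv_def)
    then have "real (evals s) \<le> 1 + real T * real (saturated_count A)"
      by (metis of_nat_1 of_nat_add of_nat_le_iff of_nat_mult)
    also have "\<dots> \<le> 1 + real T * ((real T - 1) * packing_bound)"
      using saturated_count_le[OF A(1)] by (intro add_left_mono mult_left_mono) auto
    finally show ?thesis
      by (simp add: mult.assoc)
  qed
  define E where "E = nat \<lfloor>1 + real T * (real T - 1) * packing_bound\<rfloor>"
  have evals_le: "evals s \<le> E" if "cddp_inv s" for s
    unfolding E_def using evals_real[OF that] by (rule le_nat_floor)
  let ?b = "\<lambda>s. ub s - lb s > ereal (\<delta> 1)" and ?c = "cddp_body P O1 Or"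
  have "\<exists>s. while_option ?b ?c (cddp_init P O1) = Some s"
  proof (rule measure_while_option_Some[where P = cddp_inv
        and f = "\<lambda>s. E - evals s"])
    fix s assume s: "cddp_inv s" "?b s"
    then have s': "cddp_inv (?c s)" "evals (?c s) = evals s + T"
      using cddp_inv_body by auto
    then show "cddp_inv (?c s) \<and> E - evals (?c s) < E - evals s"
      using evals_le[OF s'(1)] T_ge_2 by auto
  qed (rule cddp_inv_init)
  then obtain s where s: "while_option ?b ?c (cddp_init P O1) = Some s"
    by blast
  have "cddp_inv s"
    by (rule while_option_rule[where P = cddp_inv, OF _ s cddp_inv_init]) (use cddp_inv_body in blast)
  moreover have "\<not> ?b s"
    using while_option_stop[OF s] .
  ultimately show ?thesis
    using s evals_real[of s] by (auto simp: cddp_def cddp_inv_def not_less)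
qed


section \<open>NDDP\<close>

text \<open>Every evaluation moves one stage up or, with an update, one stage down, so the number of
  evaluations is determined by the current stage and the number of updates. Each update
  saturates a state: the gaps at the current states of the stages below remain open, since the
  approximations of a stage change only when the algorithm returns to that stage.\<close>

definition nddp_inv :: "'a nddp_run \<Rightarrow> bool" where
  "nddp_inv s \<longleftrightarrow> sound_approxs (low s) (upp s) \<and> incumbent s \<and>
     (\<exists>A. all_saturated A (low s) (upp s) \<and>
       (if halted s
        then initial_bounds s \<and> ub s - lb s \<le> ereal (\<delta> 1) \<and> evals s = 2 * saturated_count A + 1
        else 1 \<le> stage s \<and> stage s \<le> T \<and> evals s + 1 = 2 * saturated_count A + stage s \<and>
          (\<forall>j\<in>{1..<stage s}. cur s j \<in> X j \<and>
             ereal (low s j (cur s j) + \<delta> j) < upp s j (cur s j))))"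

lemma nddp_inv_init: "nddp_inv (nddp_init P)"
proof -
  have "all_saturated (\<lambda>t. {}) init_low (init_upp P)"
    by (simp add: all_saturated_def saturated_empty)
  then show ?thesis
    using T_ge_2 unfolding nddp_inv_def nddp_init_def
    by (auto simp: sound_approxs_init incumbent_def saturated_count_def intro!: exI[of _ "\<lambda>t. {}"])
qed

lemma eval_initial_nddp [simp]:
  "stage (eval_initial P O1 s) = stage s" "halted (eval_initial P O1 s) = halted s"
  by (simp_all add: eval_initial_def Let_def)

lemma nddp_inv_step_initial:
  assumes inv: "nddp_inv s" and "\<not> halted s" and t: "stage s = 1"
  shows "nddp_inv (nddp_step P O1 Or \<delta> s) \<and> evals (nddp_step P O1 Or \<delta> s) = evals s + 1"
proof -
  define s' where "s' = eval_initial P O1 s"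
  obtain A where sound: "sound_approxs (low s) (upp s)" and inc: "incumbent s"
    and A: "all_saturated A (low s) (upp s)" and ev: "evals s + 1 = 2 * saturated_count A + 1"
    using inv assms(2) t by (auto simp: nddp_inv_def)
  have bnd: "initial_bounds s'"
    unfolding s'_def using sound inc by (rule initial_bounds_eval_initial)
  have fields: "low s' = low s" "upp s' = upp s" "evals s' = Suc (evals s)" "\<not> halted s'"
    using assms(2) by (simp_all add: s'_def)
  show ?thesis
  proof (cases "ub s' - lb s' \<le> ereal (\<delta> 1)")
    case True
    then have "nddp_step P O1 Or \<delta> s = s'\<lparr>halted := True\<rparr>"
      using t by (simp add: nddp_step_def s'_def)
    moreover have "initial_bounds (s'\<lparr>halted := True\<rparr>) = initial_bounds s'" "incumbent (s'\<lparr>halted := True\<rparr>)"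
      using bnd by (simp_all add: initial_bounds_def incumbent_def)
    ultimately show ?thesis
      using sound A ev True fields bnd by (auto simp: nddp_inv_def)
  next
    case False
    then have "nddp_step P O1 Or \<delta> s = s'\<lparr>stage := 2\<rparr>"
      using t by (simp add: nddp_step_def s'_def)
    moreover have "incumbent (s'\<lparr>stage := 2\<rparr>)"
      using bnd by (simp add: initial_bounds_def incumbent_def)
    moreover have "cur s' j \<in> X j \<and> ereal (low s j (cur s' j) + \<delta> j) < upp s j (cur s' j)"
      if "1 \<le> j" "j < 2" for j
    proof -
      have "j = 1"
        using that by simp
      then show ?thesis
        using gap_open[OF bnd] False bnd by (auto simp: initial_bounds_def fields)
    qed
    ultimately show ?thesis
      using sound A ev fields T_ge_2 unfolding nddp_inv_def by (auto intro!: exI[of _ A])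
  qed
qed

lemma nddp_inv_step_noninitial:
  assumes inv: "nddp_inv s" and "\<not> halted s" and "stage s \<noteq> 1"
  shows "nddp_inv (nddp_step P O1 Or \<delta> s) \<and> evals (nddp_step P O1 Or \<delta> s) = evals s + 1"
proof -
  obtain A where sound: "sound_approxs (low s) (upp s)" and inc: "incumbent s"
    and A: "all_saturated A (low s) (upp s)" and ev: "evals s + 1 = 2 * saturated_count A + stage s"
    and stage: "1 \<le> stage s" "stage s \<le> T"
    and opens: "\<And>j. 1 \<le> j \<Longrightarrow> j < stage s \<Longrightarrow> cur s j \<in> X j \<and>
       ereal (low s j (cur s j) + \<delta> j) < upp s j (cur s j)"
    using inv assms(2) by (auto simp: nddp_inv_def)
  obtain t where t: "stage s = Suc t" "1 \<le> t" "t < T"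
    using stage assms(3) by (cases "stage s") auto
  define x where "x = cur s t"
  define r where "r = Or (Suc t) x (low s (Suc t)) (upp s (Suc t))"
  have x: "x \<in> X t" "ereal (low s t x + \<delta> t) < upp s t x"
    using opens[of t] t by (auto simp: x_def)
  note answer = stage_oracle[OF t(2,3) x(1) sound r_def]
  show ?thesis
  proof (cases "Suc t < T \<and> ereal (\<delta> (Suc t)) < out_gap r")
    case True
    define s' where "s' = s\<lparr>cur := (cur s)(Suc t := out_state r), evals := evals s + 1,
      stage := Suc (Suc t)\<rparr>"
    have step: "nddp_step P O1 Or \<delta> s = s'"
      using True t by (simp add: nddp_step_def Let_def r_def x_def s'_def)
    have "ereal (low s (Suc t) (out_state r) + \<delta> (Suc t)) < upp s (Suc t) (out_state r)"
      using True answer(3) by (cases "upp s (Suc t) (out_state r)") auto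
    then have "cur s' j \<in> X j \<and> ereal (low s j (cur s' j) + \<delta> j) < upp s j (cur s' j)"
      if "1 \<le> j" "j < Suc (Suc t)" for j
      using opens[of j] that answer(1) t by (cases "j = Suc t") (auto simp: s'_def)
    moreover have "incumbent s'"
      using inc by (simp add: incumbent_def s'_def)
    ultimately show ?thesis
      using sound A ev t True assms(2) unfolding step nddp_inv_def
      by (auto simp: s'_def intro!: exI[of _ A])
  next
    case False
    define lo where "lo = (low s)(t := refine_low (low s t) r)"
    define hi where "hi = (upp s)(t := refine_upp P (Suc t) (upp s t) r x)"
    define s' where "s' = s\<lparr>cur := (cur s)(Suc t := out_state r), evals := evals s + 1,
      low := lo, upp := hi, stage := t\<rparr>"
    have step: "nddp_step P O1 Or \<delta> s = s'"
      using False t by (auto simp: nddp_step_def Let_def r_def x_def s'_def lo_def hi_def)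
    have closed: "out_gap r \<le> ereal (\<delta> (Suc t))"
    proof (cases "Suc t < T")
      case True
      then show ?thesis
        using False by auto
    next
      case False
      then have "Suc t = T"
        using t by simp
      then show ?thesis
        using answer(3) sound by (simp add: sound_approxs_def \<delta>_last)
    qed
    have At: "saturated t (A t) (low s t) (upp s t)"
      using A t by (auto simp: all_saturated_def)
    note new = saturated_insert[OF t(2,3) At x(1,2) answer(2) closed]
    define B where "B = A(t := insert x (A t))"
    have B: "all_saturated B lo hi"
      using A new(2) by (auto simp: all_saturated_def B_def lo_def hi_def)
    have saturated_count: "saturated_count B = saturated_count A + 1"
      unfolding B_def using saturated_count_insert[OF t(2,3) A new(1)] .
    have sound': "sound_approxs lo hi"
      using sound t sound_approx_refine[OF t(2,3) x(1) _ answer(2)]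
      by (auto simp: sound_approxs_def lo_def hi_def)
    have "cur s' j \<in> X j \<and> ereal (lo j (cur s' j) + \<delta> j) < hi j (cur s' j)"
      if "1 \<le> j" "j < t" for j
      using opens[of j] that t by (auto simp: s'_def lo_def hi_def)
    moreover have "incumbent s'"
      using inc by (simp add: incumbent_def s'_def)
    ultimately show ?thesis
      using sound' B ev saturated_count t assms(2) unfolding step nddp_inv_def
      by (auto simp: s'_def intro!: exI[of _ B])
  qed
qed

lemma nddp_terminates:
  "\<exists>s. nddp P O1 Or \<delta> = Some s \<and> initial_bounds s \<and> ub s - lb s \<le> ereal (\<delta> 1) \<and>
     real (evals s) \<le> 1 + 2 * (real T - 1) * packing_bound"
proof -
  let ?b = "\<lambda>s. \<not> halted s" and ?c = "nddp_step P O1 Or \<delta>"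
  have saturated_count_le': "saturated_count A \<le> nat \<lfloor>(real T - 1) * packing_bound\<rfloor>" if "all_saturated A lo hi" for A lo hi
    using saturated_count_le[OF that] by (simp add: le_nat_floor)
  define E where "E = 2 * nat \<lfloor>(real T - 1) * packing_bound\<rfloor> + T + 1"
  have evals_le: "evals s \<le> E" if "nddp_inv s" for s
    using that saturated_count_le' unfolding nddp_inv_def E_def by (fastforce split: if_splits)
  have step: "nddp_inv (?c s) \<and> evals (?c s) = evals s + 1" if "nddp_inv s" "?b s" for s
    using nddp_inv_step_initial nddp_inv_step_noninitial that by blast
  have "\<exists>s. while_option ?b ?c (nddp_init P) = Some s"
  proof (rule measure_while_option_Some[where P = nddp_inv and f = "\<lambda>s. E - evals s"])
    fix s assume "nddp_inv s" "?b s"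
    then have s': "nddp_inv (?c s)" "evals (?c s) = evals s + 1"
      using step by auto
    then show "nddp_inv (?c s) \<and> E - evals (?c s) < E - evals s"
      using evals_le[OF s'(1)] by auto
  qed (rule nddp_inv_init)
  then obtain s where s: "while_option ?b ?c (nddp_init P) = Some s"
    by blast
  have "nddp_inv s"
    by (rule while_option_rule[where P = nddp_inv, OF _ s nddp_inv_init]) (use step in blast)
  moreover have "halted s"
    using while_option_stop[OF s] by simp
  ultimately obtain A where A: "all_saturated A (low s) (upp s)" and fin: "initial_bounds s"
    "ub s - lb s \<le> ereal (\<delta> 1)" "evals s = 2 * saturated_count A + 1"
    by (auto simp: nddp_inv_def)
  have "real (evals s) \<le> 1 + 2 * (real T - 1) * packing_bound"
    unfolding mult.assoc using saturated_count_le[OF A] fin(3) by linarith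
  then show ?thesis
    using s fin by (auto simp: nddp_def)
qed

end


section \<open>The complexity bounds\<close>

theorem corollary1:
  fixes P :: "('b::euclidean_space, 'a::euclidean_space, 'm::euclidean_space) problem"
    and diam :: "nat \<Rightarrow> real" and D M C \<alpha> :: real
  assumes "valid_problem P"
    and "regularity P"
    and "\<forall>t\<in>{1..horizon P}.
           diam t \<le> D \<and> (\<exists>c. state_set P t \<subseteq> norm_cball (nrm P t) c (diam t / 2))"
    and "M = Max (lip P ` {2..horizon P})"
    and "C > 0"
    and "\<forall>y\<in>state_set P 1. \<forall>xi\<in>unc_set P 1. cost1 P (init_state P) y xi \<ge> ennreal C"
    and "\<forall>t\<in>{2..horizon P}. \<forall>x\<in>state_set P (t - 1). \<forall>y\<in>state_set P t. \<forall>xi\<in>unc_set P t.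
           cost P t x y xi \<ge> ennreal C"
    and "\<alpha> > 0"
  shows "(\<exists>\<epsilon>>0. \<forall>O1 Or. valid_oracles P O1 Or \<longrightarrow>
            (\<exists>s x. cddp P O1 Or \<epsilon> = Some s \<and> best s = Some x \<and>
               alpha_relative_optimal P \<alpha> x \<and>
               real (evals s) \<le> 1 + real (horizon P) * (real (horizon P) - 1) *
                 (1 + 2 * M * D / (\<alpha> * C)) ^ DIM('a))) \<and>
         (\<exists>\<delta>. gap_vector (horizon P) \<delta> \<and>
            (\<forall>O1 Or. valid_oracles P O1 Or \<longrightarrow>
              (\<exists>s x. nddp P O1 Or \<delta> = Some s \<and> best s = Some x \<and>
                 alpha_relative_optimal P \<alpha> x \<and>
                 real (evals s) \<le> 1 + 2 * (real (horizon P) - 1) *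
                   (1 + 2 * M * D / (\<alpha> * C)) ^ DIM('a))))"
proof -
  define \<delta> where "\<delta> t = real (horizon P - t) * (\<alpha> * C)" for t
  have T: "2 \<le> horizon P"
    using assms(1) by (simp add: valid_problem_def)
  have pos: "0 < \<alpha> * C"
    using assms(5,8) by simp
  have "0 < \<delta> 1"
    using T pos by (simp add: \<delta>_def)
  have "gap_vector (horizon P) \<delta>"
    using pos by (auto simp: gap_vector_def \<delta>_def of_nat_diff algebra_simps)
  have lip_le: "lip P (Suc t) \<le> M" if "1 \<le> t" "t < horizon P" for t
    unfolding assms(4) using that by (intro Max_ge) auto
  have X_bounded: "\<exists>c. state_set P t \<subseteq> norm_cball (nrm P t) c (D / 2)"
    if t: "1 \<le> t" "t < horizon P" for t
  proof -
    obtain c where "diam t \<le> D" "state_set P t \<subseteq> norm_cball (nrm P t) c (diam t / 2)"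
      using assms(3) t by (meson atLeastAtMost_iff less_imp_le)
    then show ?thesis
      by (intro exI[of _ c]) (fastforce simp: norm_cball_def)
  qed
  have first_ge: "ennreal C \<le> first_cost P y" if "y \<in> state_set P 1" for y
    using assms(1,6) that by (simp add: first_cost_def valid_problem_def)
  have cost_ge: "ennreal C \<le> cost P (Suc t) x y xi"
    if "1 \<le> t" "t < horizon P" "x \<in> state_set P t" "y \<in> state_set P (Suc t)"
      "xi \<in> unc_set P (Suc t)" for t x y xi
    using assms(7)[rule_format, of "Suc t" x y xi] that by simp
  have "(\<exists>s x. cddp P O1 Or (\<delta> 1) = Some s \<and> best s = Some x \<and> alpha_relative_optimal P \<alpha> x \<and>
      real (evals s) \<le> 1 + real (horizon P) * (real (horizon P) - 1) *
        (1 + 2 * M * D / (\<alpha> * C)) ^ DIM('a)) \<and>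
    (\<exists>s x. nddp P O1 Or \<delta> = Some s \<and> best s = Some x \<and> alpha_relative_optimal P \<alpha> x \<and>
      real (evals s) \<le> 1 + 2 * (real (horizon P) - 1) * (1 + 2 * M * D / (\<alpha> * C)) ^ DIM('a))"
    if "valid_oracles P O1 Or" for O1 Or
  proof -
    interpret run: multistage_run P O1 Or "\<alpha> * C" M D
      using assms(1,2) that pos lip_le X_bounded by unfold_locales
    have \<delta>_eq: "run.\<delta> = \<delta>"
      by (simp add: fun_eq_iff run.\<delta>_def \<delta>_def)
    have optimal: "\<exists>x. best s = Some x \<and> alpha_relative_optimal P \<alpha> x"
      if "run.initial_bounds s" "ub s - lb s \<le> ereal (\<delta> 1)" for s :: "('a, 'z) run_scheme"
      using run.initial_bounds_alpha_relative_optimal[of s \<alpha> C] that assms(5,8) first_ge cost_ge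
      by (simp add: \<delta>_eq)
    show ?thesis
      using run.cddp_terminates run.nddp_terminates unfolding \<delta>_eq run.packing_bound_def
      by (blast dest: optimal)
  qed
  then show ?thesis
    using \<open>0 < \<delta> 1\<close> \<open>gap_vector (horizon P) \<delta>\<close> by blast
qed

end
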